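(* The system of infinite-valued logic with axioms A1 $=i(x,i(y,x))$, A2 $=i(i(x,y),i(i(y,z),i(x,z)))$, A3 $=i(i(i(x,y),y),i(i(y,x),x))$, A4 $=i(i(n(x),n(y)),i(y,x))$ and condensed detachment as sole rule of inference admits strong double-negation elimination.
   Context: Formulas are terms built from propositional variables using the binary connective $i$ (implication) and the unary connective $n$ (negation). Condensed detachment: from a major premiss $i(A,B)$ and a minor premiss $C$, after renaming variables so that the two premisses share no variables, if $A$ and $C$ are unifiable with most general unifier $\sigma$, infer $B\sigma$. Alphabetic variants of axioms count as axioms, and conclusions may be renamed. A proof is a finite sequence of formulas each an axiom or obtained from earlier lines by the rule; deduced steps are the non-axiom lines. Given a formula $B$, a formula $B^*$ is obtained from $B$ by selecting some set of doubly negated subformulas $n(n(q))$ of $B$ and replacing all occurrences of each selected subformula by $q$. A system admits strong double-negation elimination if whenever it proves $B$ and $B^*$ is obtained from $B$ in this way, there is a proof of $B^*$ in the system in which every subformula of the form $n(n(t))$ of a deduced step occurs (up to renaming of variables) as a subformula of $B^*$. *)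

theory Defs
  imports Main
begin

datatype form = Var nat | I form form | N form

primrec subst :: "(nat \<Rightarrow> form) \<Rightarrow> form \<Rightarrow> form" where
  "subst s (Var v) = s v"
| "subst s (I a b) = I (subst s a) (subst s b)"
| "subst s (N a) = N (subst s a)"

primrec vars :: "form \<Rightarrow> nat set" where
  "vars (Var v) = {v}"
| "vars (I a b) = vars a \<union> vars b"
| "vars (N a) = vars a"

primrec subforms :: "form \<Rightarrow> form set" where
  "subforms (Var v) = {Var v}"
| "subforms (I a b) = insert (I a b) (subforms a \<union> subforms b)"
| "subforms (N a) = insert (N a) (subforms a)"

definition variant :: "form \<Rightarrow> form \<Rightarrow> bool" where
  "variant F G \<longleftrightarrow> (\<exists>r::nat \<Rightarrow> nat. inj r \<and> subst (Var \<circ> r) F = G)"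

definition is_mgu :: "(nat \<Rightarrow> form) \<Rightarrow> form \<Rightarrow> form \<Rightarrow> bool" where
  "is_mgu s A C \<longleftrightarrow> subst s A = subst s C \<and>
     (\<forall>t. subst t A = subst t C \<longrightarrow> (\<exists>r. \<forall>v. t v = subst r (s v)))"

definition cd :: "form \<Rightarrow> form \<Rightarrow> form \<Rightarrow> bool" where
  "cd M m R \<longleftrightarrow> (\<exists>A B C s. variant M (I A B) \<and> variant m C \<and>
      vars (I A B) \<inter> vars C = {} \<and> is_mgu s A C \<and> variant (subst s B) R)"

definition is_axiom :: "form set \<Rightarrow> form \<Rightarrow> bool" where
  "is_axiom Ax F \<longleftrightarrow> (\<exists>a\<in>Ax. variant a F)"

definition is_proof :: "form set \<Rightarrow> form list \<Rightarrow> bool" where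
  "is_proof Ax P \<longleftrightarrow> (\<forall>k<length P. is_axiom Ax (P!k) \<or>
      (\<exists>i<k. \<exists>j<k. cd (P!i) (P!j) (P!k)))"

definition proves :: "form set \<Rightarrow> form \<Rightarrow> bool" where
  "proves Ax B \<longleftrightarrow> (\<exists>P. is_proof Ax P \<and> P \<noteq> [] \<and> last P = B)"

definition deduced_steps :: "form set \<Rightarrow> form list \<Rightarrow> form set" where
  "deduced_steps Ax P = {F \<in> set P. \<not> is_axiom Ax F}"

fun dn_repl :: "form set \<Rightarrow> form \<Rightarrow> form" where
  "dn_repl S (Var v) = Var v"
| "dn_repl S (I a b) = I (dn_repl S a) (dn_repl S b)"
| "dn_repl S (N a) = (if N a \<in> S then (case a of N q \<Rightarrow> dn_repl S q | _ \<Rightarrow> N (dn_repl S a))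
                        else N (dn_repl S a))"

definition dn_star :: "form \<Rightarrow> form \<Rightarrow> bool" where
  "dn_star B Bs \<longleftrightarrow> (\<exists>S. S \<subseteq> {F \<in> subforms B. \<exists>q. F = N (N q)} \<and> Bs = dn_repl S B)"

definition admits_strong_dne :: "form set \<Rightarrow> bool" where
  "admits_strong_dne Ax \<longleftrightarrow> (\<forall>B Bs. proves Ax B \<and> dn_star B Bs \<longrightarrow>
     (\<exists>P. is_proof Ax P \<and> P \<noteq> [] \<and> last P = Bs \<and>
        (\<forall>F\<in>deduced_steps Ax P. \<forall>t. N (N t) \<in> subforms F \<longrightarrow>
            (\<exists>G\<in>subforms Bs. variant (N (N t)) G))))"

definition x :: form where "x = Var 0"
definition y :: form where "y = Var 1"
definition z :: form where "z = Var 2"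

definition A1 :: form where "A1 = I x (I y x)"
definition A2 :: form where "A2 = I (I x y) (I (I y z) (I x z))"
definition A3 :: form where "A3 = I (I (I x y) y) (I (I y x) x)"
definition A4 :: form where "A4 = I (I (N x) (N y)) (I y x)"

end

theory Submission
  imports Defs
begin

text \<open>Removing all double negations from a proof, read as a proof by substitution and modus ponens,
  turns the axioms into instances of A1--A4 or of one of three contraposition laws, which have proofs
  free of double negation. By unification, condensed detachment then derives, without double negations,
  a formula that has the fully reduced form of \<open>B\<^sup>*\<close> as an instance.

  To get \<open>B\<^sup>*\<close> itself it suffices to derive \<open>red B\<^sup>* \<rightarrow> B\<^sup>*\<close>, by induction on subformulas. Variables
  shared by two subformulas have to be identified before a double negation is put around them, since
  a more general double negation would be a forbidden subformula. This is possible because axiom A3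
  can force two formulas to be unified.\<close>

text \<open>Condensed detachment has no substitution rule, so a derivation of a formula does not by
  itself yield its proper instances:
  \<open>(p \<rightarrow> p) \<rightarrow> p \<rightarrow> p\<close> needs a derivation of its own
  although \<open>p \<rightarrow> p\<close> is a theorem. Among formulas without double negations
  this loss of control is harmless, because every generalisation of such a formula is again free of
  them. Near \<open>B\<^sup>*\<close> it is fatal, and each law used there must come with an exact
  variable pattern, certified by showing that the displayed unifier is most general. To keep
  variables shared, formulas carry premisses that mention these variables, and combining two
  theorems duplicates the premisses. Contraction \<open>(x \<rightarrow> x \<rightarrow> y)
  \<rightarrow> x \<rightarrow> y\<close> is not valid in infinite-valued logic. Premisses of the
  form \<open>p \<rightarrow> p\<close>, called tags below, avoid this obstacle: being theorems,
  they can be contracted and in the end detached, while they still expose \<open>p\<close> to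
  unification.\<close>

notation Var ("\<langle>_\<rangle>")
notation I (infixr "\<rightarrow>" 65)
notation N ("\<sim>_" [80] 80)

section \<open>Substitutions and variants\<close>

lemma subst_subst: "subst s (subst t F) = subst (\<lambda>v. subst s (t v)) F"
  by (induction F) auto

lemma subst_eq_iff: "subst s F = subst t F \<longleftrightarrow> (\<forall>v\<in>vars F. s v = t v)"
  by (induction F) auto

lemma subst_Var [simp]: "subst Var F = F"
  by (induction F) auto

lemma subst_ident: "(\<And>v. v \<in> vars F \<Longrightarrow> s v = \<langle>v\<rangle>) \<Longrightarrow> subst s F = F"
  using subst_eq_iff[of s F Var] by simp

lemma vars_subst: "vars (subst s F) = (\<Union>v\<in>vars F. vars (s v))"
  by (induction F) auto

lemma finite_vars [simp]: "finite (vars F)"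
  by (induction F) auto

lemma subforms_refl [simp]: "F \<in> subforms F"
  by (cases F) auto

lemma subforms_subst: "G \<in> subforms F \<Longrightarrow> subst s G \<in> subforms (subst s F)"
  by (induction F) (auto simp: subforms_refl)

lemma subforms_renaming:
  assumes "G \<in> subforms (subst (Var \<circ> r) F)"
  shows "\<exists>H\<in>subforms F. G = subst (Var \<circ> r) H"
  using assms by (induction F) auto

text \<open>This is the occurs check of unification: no substitution can equalise \<open>v\<close>
  with a larger formula that contains it.\<close>

lemma size_less_size_subst: "v \<in> vars F \<Longrightarrow> F \<noteq> \<langle>v\<rangle> \<Longrightarrow> size (s v) < size (subst s F)"
proof (induction F)
  case (I a b)
  then show ?case by (cases "a = \<langle>v\<rangle>"; cases "b = \<langle>v\<rangle>") auto
next
  case (N a)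
  then show ?case by (cases "a = \<langle>v\<rangle>") auto
qed simp

text \<open>Only finitely many variables occur, so a renaming that is injective on them becomes
  globally injective once all other variables are shifted beyond its image.\<close>

lemma variant_iff: "variant F G \<longleftrightarrow> (\<exists>r. inj_on r (vars F) \<and> subst (Var \<circ> r) F = G)"
proof
  assume "\<exists>r. inj_on r (vars F) \<and> subst (Var \<circ> r) F = G"
  then obtain r where r: "inj_on r (vars F)" "subst (Var \<circ> r) F = G" by blast
  define m where "m = Suc (Max (insert 0 (r ` vars F)))"
  have m: "r v < m" if "v \<in> vars F" for v
    using that by (auto simp: m_def less_Suc_eq_le intro!: Max_ge)
  define r' where "r' v = (if v \<in> vars F then r v else m + v)" for v
  have "inj r'"
  proof (rule injI)
    fix u v assume "r' u = r' v"
    then show "u = v"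
      using m[of u] m[of v] r(1) by (auto simp: r'_def inj_on_def split: if_splits)
  qed
  moreover have "subst (Var \<circ> r') F = G"
    unfolding r(2)[symmetric] subst_eq_iff by (simp add: r'_def)
  ultimately show "variant F G" unfolding variant_def by blast
next
  assume "variant F G"
  then obtain r where "inj r" "subst (Var \<circ> r) F = G" unfolding variant_def by auto
  moreover from this(1) have "inj_on r (vars F)" by (rule inj_on_subset) simp
  ultimately show "\<exists>r. inj_on r (vars F) \<and> subst (Var \<circ> r) F = G" by blast
qed

text \<open>The composition of the two substitutions fixes each variable of \<open>F\<close>, so the
  first one can only send variables to variables, and injectively. This is how a most general
  conclusion is later recognised as the intended one.\<close>

lemma variant_if_instances:
  assumes "subst s F = G" "subst t G = F"
  shows "variant F G"
proof -
  have id: "subst t (s v) = \<langle>v\<rangle>" if "v \<in> vars F" for v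
    using that subst_eq_iff[of "\<lambda>v. subst t (s v)" F Var] subst_subst[of t s F]
    by (simp add: assms)
  have "\<exists>w. s v = \<langle>w\<rangle>" if "v \<in> vars F" for v
    using id[OF that] by (cases "s v") auto
  then obtain r where r: "\<And>v. v \<in> vars F \<Longrightarrow> s v = \<langle>r v\<rangle>" by metis
  have "inj_on r (vars F)"
    by (rule inj_onI) (metis id r form.inject(1))
  moreover have "subst (Var \<circ> r) F = G"
    unfolding assms(1)[symmetric] subst_eq_iff by (simp add: r)
  ultimately show ?thesis unfolding variant_iff by blast
qed

lemma variant_refl [simp]: "variant F F"
  by (rule variant_if_instances[of Var _ _ Var]) auto

lemma variant_trans: "variant F G \<Longrightarrow> variant G H \<Longrightarrow> variant F H"
proof -
  assume "variant F G" "variant G H"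
  then obtain r q where *: "inj r" "subst (Var \<circ> r) F = G" "inj q" "subst (Var \<circ> q) G = H"
    unfolding variant_def by (elim exE conjE)
  have "inj (q \<circ> r)" "subst (Var \<circ> (q \<circ> r)) F = H"
    by (rule inj_compose[OF *(3,1)]) (use *(2,4) subst_subst[of "Var \<circ> q" "Var \<circ> r" F] in \<open>simp add: comp_def\<close>)
  then show ?thesis unfolding variant_def by (intro exI conjI)
qed

lemma variant_sym:
  assumes "variant F G" shows "variant G F"
proof -
  obtain r where r: "inj r" "subst (Var \<circ> r) F = G" using assms unfolding variant_def by blast
  have "subst (Var \<circ> inv r) G = F"
    unfolding r(2)[symmetric] subst_subst using r(1) by (simp add: subst_ident)
  then show ?thesis using r(2) by (rule variant_if_instances)
qed

lemma variant_subst: "variant F G \<Longrightarrow> \<exists>t. subst s G = subst t F"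
  unfolding variant_def by (auto simp: subst_subst)

section \<open>Most general unifiers and condensed detachment\<close>

definition unifies :: "(nat \<Rightarrow> form) \<Rightarrow> (form \<times> form) list \<Rightarrow> bool" where
  "unifies s E \<longleftrightarrow> (\<forall>(a, b)\<in>set E. subst s a = subst s b)"

lemma unifies_simps [simp]:
  "unifies s []"
  "unifies s ((a, b) # E) \<longleftrightarrow> subst s a = subst s b \<and> unifies s E"
  by (auto simp: unifies_def)

text \<open>Measuring the system after applying the given unifier \<open>t\<close> makes variable elimination,
  which may enlarge the equations themselves, decrease the measure.\<close>

lemma unifies_mgu:
  assumes "unifies t E"
  shows "\<exists>s. unifies s E \<and> (\<forall>t. unifies t E \<longrightarrow> (\<forall>v. t v = subst t (s v)))"
  using assms
\<comment> \<open>The factor 2 pays for the extra equation when an implication is split in two; the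
  successor makes the removal of any equation count.\<close>
proof (induction "\<Sum>e\<leftarrow>E. Suc (2 * size (subst t (fst e)))" arbitrary: E rule: less_induct)
  case less
  have elim: ?case if E: "E = (\<langle>v\<rangle>, a) # E' \<or> E = (a, \<langle>v\<rangle>) # E'" and a: "a \<noteq> \<langle>v\<rangle>" for v a E'
  proof -
    have tv: "t v = subst t a" using less.prems E by auto
    have v: "v \<notin> vars a"
    proof
      assume "v \<in> vars a"
      then have "size (t v) < size (subst t a)"
        using a by (rule size_less_size_subst)
      with tv show False by simp
    qed
    define e where "e = Var(v := a)"
    have e: "subst u (subst e b) = subst u b" if "u v = subst u a" for u b
      unfolding subst_subst subst_eq_iff using that by (simp add: e_def)
    define E2 where "E2 = map (\<lambda>(b, c). (subst e b, subst e c)) E'"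
    have map: "unifies u E2 \<longleftrightarrow> unifies u E'" if "u v = subst u a" for u
      using e[of u, OF that] by (auto simp: unifies_def E2_def)
    have E2: "unifies t E2" using map[OF tv] less.prems E by auto
    have "(\<Sum>e\<leftarrow>E2. Suc (2 * size (subst t (fst e)))) < (\<Sum>e\<leftarrow>E. Suc (2 * size (subst t (fst e))))"
      using E e[OF tv] by (auto simp: E2_def comp_def case_prod_beta)
    from less.hyps[OF this E2]
    obtain s where s: "unifies s E2" "\<And>t v. unifies t E2 \<Longrightarrow> t v = subst t (s v)"
      by auto
    define s' where "s' = (\<lambda>w. subst s (e w))"
    have "subst e a = a"
      by (rule subst_ident) (use v in \<open>auto simp: e_def\<close>)
    then have s'_a: "subst s' a = subst s a"
      using subst_subst[of s e a] by (simp add: s'_def)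
    have "unifies s' E'"
      using s(1) by (auto simp: unifies_def s'_def subst_subst E2_def)
    moreover have "s' v = subst s' a" unfolding s'_a by (simp add: s'_def e_def)
    ultimately have "unifies s' E" using E by auto
    moreover have "u w = subst u (s' w)" if "unifies u E" for u w
    proof -
      have uv: "u v = subst u a" using that E by auto
      have "unifies u E2" using map[OF uv] that E by auto
      then have "subst u (s' w) = subst u (e w)"
        unfolding s'_def subst_subst subst_eq_iff using s(2)[of u, symmetric] by simp
      also have "\<dots> = u w" using uv by (simp add: e_def)
      finally show ?thesis by simp
    qed
    ultimately show ?thesis by blast
  qed
  have step: ?case if "\<And>u. unifies u E \<longleftrightarrow> unifies u E'"
    "(\<Sum>e\<leftarrow>E'. Suc (2 * size (subst t (fst e)))) < (\<Sum>e\<leftarrow>E. Suc (2 * size (subst t (fst e))))" for E'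
    using less.hyps[of E'] less.prems that by simp
  show ?case
  proof (cases E)
    case Nil
    then show ?thesis by (intro exI[of _ Var]) simp
  next
    case (Cons p E')
    then obtain a b where E: "E = (a, b) # E'" by (cases p) auto
    show ?thesis
    proof (cases "\<exists>v. a = \<langle>v\<rangle> \<or> b = \<langle>v\<rangle>")
      case True
      then consider v where "a = \<langle>v\<rangle>" | v where "b = \<langle>v\<rangle>" by auto
      then show ?thesis
      proof cases
        case 1
        show ?thesis
        proof (cases "b = a")
          case False
          then show ?thesis using E 1 by (intro elim[of v b E']) simp_all
        next
          case True
          then show ?thesis using E by (intro step[of E']) simp_all
        qed
      next
        case 2
        show ?thesis
        proof (cases "a = b")
          case False
          then show ?thesis using E 2 by (intro elim[of v a E']) simp_all
        next
          case True
          then show ?thesis using E by (intro step[of E']) simp_all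
        qed
      qed
    next
      case False
      show ?thesis
      proof (cases a)
        case (I a1 a2)
        with False E less.prems obtain b1 b2 where "b = b1 \<rightarrow> b2" by (cases b) auto
        with I E show ?thesis by (intro step[of "(a1, b1) # (a2, b2) # E'"]) auto
      next
        case (N a1)
        with False E less.prems obtain b1 where "b = \<sim>b1" by (cases b) auto
        with N E show ?thesis by (intro step[of "(a1, b1) # E'"]) auto
      qed (use False in auto)
    qed
  qed
qed

lemma mgu_exists:
  assumes "subst t a = subst t b"
  shows "\<exists>s. is_mgu s a b"
  using unifies_mgu[of t "[(a, b)]"] assms unfolding is_mgu_def by (simp, blast)

text \<open>Renaming the premisses apart allows two independent substitutions.\<close>

lemma cd_exists:
  assumes "subst \<sigma> a = subst \<tau> c"
  shows "\<exists>s t \<rho>. cd (a \<rightarrow> b) c (subst s b) \<and> subst s a = subst t c \<and> subst \<rho> (subst s b) = subst \<sigma> b"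
proof -
  define l r :: "nat \<Rightarrow> nat" where "l v = 2 * v" and "r v = Suc (2 * v)" for v
  have inj: "inj l" "inj r" by (auto simp: l_def r_def inj_def)
  define u where "u v = (if even v then \<sigma> (v div 2) else \<tau> (v div 2))" for v
  have u: "subst u (subst (Var \<circ> l) F) = subst \<sigma> F" "subst u (subst (Var \<circ> r) F) = subst \<tau> F" for F
    by (simp_all add: subst_subst l_def r_def u_def)
  obtain g where g: "is_mgu g (subst (Var \<circ> l) a) (subst (Var \<circ> r) c)"
    using mgu_exists[of u] assms u by metis
  then obtain \<rho> where \<rho>: "\<And>v. u v = subst \<rho> (g v)"
    using assms u unfolding is_mgu_def by metis
  have "vars (subst (Var \<circ> l) (a \<rightarrow> b)) \<inter> vars (subst (Var \<circ> r) c) = {}"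
    by (auto simp: vars_subst l_def r_def) presburger+
  moreover have "variant (a \<rightarrow> b) (subst (Var \<circ> l) (a \<rightarrow> b))" "variant c (subst (Var \<circ> r) c)"
    using inj unfolding variant_def by blast+
  ultimately have "cd (a \<rightarrow> b) c (subst g (subst (Var \<circ> l) b))"
    using g unfolding cd_def by (metis subst.simps(2) variant_refl)
  moreover have "subst g (subst (Var \<circ> l) a) = subst g (subst (Var \<circ> r) c)"
    using g unfolding is_mgu_def by blast
  moreover have "subst \<rho> (subst g (subst (Var \<circ> l) b)) = subst \<sigma> b"
    unfolding u(1)[symmetric] subst_subst[of \<rho>] by (simp add: \<rho>[symmetric])
  ultimately show ?thesis unfolding subst_subst[of g] by blast
qed

section \<open>Derivations with restricted double negations\<close>

text \<open>Proof trees replace sequences. The predicate \<open>ok\<close> restricts only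
  conclusions of detachments, as axioms are not deduced steps; the trivial \<open>ok\<close> gives
  plain provability.\<close>

inductive der :: "form set \<Rightarrow> (form \<Rightarrow> bool) \<Rightarrow> form \<Rightarrow> bool" for Ax ok where
  ax: "is_axiom Ax F \<Longrightarrow> der Ax ok F"
| cd: "der Ax ok M \<Longrightarrow> der Ax ok m \<Longrightarrow> cd M m R \<Longrightarrow> ok R \<Longrightarrow> der Ax ok R"

lemma proves_der:
  assumes "proves Ax F" shows "der Ax (\<lambda>_. True) F"
proof -
  obtain P where P: "is_proof Ax P" "P \<noteq> []" "last P = F" using assms unfolding proves_def by blast
  have "der Ax (\<lambda>_. True) (P ! k)" if "k < length P" for k
    using that
  proof (induction k rule: less_induct)
    case (less k)
    then consider "is_axiom Ax (P ! k)" | i j where "i < k" "j < k" "cd (P ! i) (P ! j) (P ! k)"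
      using P(1) unfolding is_proof_def by blast
    then show ?case
    proof cases
      case 2
      show ?thesis by (rule der.cd[OF less(1) less(1) 2(3)]) (use 2 less in auto)
    qed (rule der.ax)
  qed
  from this[of "length P - 1"] show ?thesis using P by (simp add: last_conv_nth)
qed

lemma is_proof_append:
  assumes "is_proof Ax P" "is_proof Ax Q" shows "is_proof Ax (P @ Q)"
  unfolding is_proof_def
proof (intro allI impI)
  fix k assume k: "k < length (P @ Q)"
  show "is_axiom Ax ((P @ Q) ! k) \<or> (\<exists>i<k. \<exists>j<k. cd ((P @ Q) ! i) ((P @ Q) ! j) ((P @ Q) ! k))"
  proof (cases "k < length P")
    case True
    then consider "is_axiom Ax (P ! k)" | i j where "i < k" "j < k" "cd (P ! i) (P ! j) (P ! k)"
      using assms(1) unfolding is_proof_def by blast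
    then show ?thesis
    proof cases
      case 2
      with True have "cd ((P @ Q) ! i) ((P @ Q) ! j) ((P @ Q) ! k)"
        by (simp only: nth_append_left less_trans[of _ k])
      with 2 show ?thesis by blast
    qed (simp add: True nth_append_left)
  next
    case False
    define k' where "k' = k - length P"
    have k': "k = length P + k'" "k' < length Q" using False k by (auto simp: k'_def)
    then consider "is_axiom Ax (Q ! k')" | i j where "i < k'" "j < k'" "cd (Q ! i) (Q ! j) (Q ! k')"
      using assms(2) unfolding is_proof_def by blast
    then show ?thesis
    proof cases
      case 2
      have "cd ((P @ Q) ! (length P + i)) ((P @ Q) ! (length P + j)) ((P @ Q) ! k)"
        unfolding k'(1) nth_append_length_plus by (rule 2(3))
      moreover have "length P + i < k" "length P + j < k" using 2 k' by auto
      ultimately show ?thesis by blast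
    qed (simp add: k' nth_append)
  qed
qed

lemma der_proof:
  assumes "der Ax ok F"
  shows "\<exists>P. is_proof Ax P \<and> P \<noteq> [] \<and> last P = F \<and> (\<forall>G\<in>deduced_steps Ax P. ok G)"
  using assms
proof induction
  case (ax F)
  then show ?case by (intro exI[of _ "[F]"]) (simp add: is_proof_def deduced_steps_def)
next
  case (cd M m R)
  then obtain P Q where P: "is_proof Ax P" "P \<noteq> []" "last P = M" "\<forall>G\<in>deduced_steps Ax P. ok G"
    and Q: "is_proof Ax Q" "Q \<noteq> []" "last Q = m" "\<forall>G\<in>deduced_steps Ax Q. ok G" by blast
  let ?P = "P @ Q"
  have PQ: "is_proof Ax ?P" using P(1) Q(1) by (rule is_proof_append)
  have M: "?P ! (length P - 1) = M" "length P - 1 < length ?P"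
    using P(2,3) by (cases P; auto simp: nth_append last_conv_nth)+
  have m: "?P ! (length ?P - 1) = m" "length ?P - 1 < length ?P"
    using Q(2,3) last_conv_nth[of ?P] by auto
  have "is_proof Ax (?P @ [R])"
    unfolding is_proof_def
  proof (intro allI impI)
    fix k assume "k < length (?P @ [R])"
    then consider "k < length ?P" | "k = length ?P" by force
    then show "is_axiom Ax ((?P @ [R]) ! k) \<or>
      (\<exists>i<k. \<exists>j<k. cd ((?P @ [R]) ! i) ((?P @ [R]) ! j) ((?P @ [R]) ! k))"
    proof cases
      case 1
      then consider "is_axiom Ax (?P ! k)" | i j where "i < k" "j < k" "cd (?P ! i) (?P ! j) (?P ! k)"
        using PQ unfolding is_proof_def by blast
      then show ?thesis
      proof cases
        case 1
        with \<open>k < length ?P\<close> show ?thesis by (simp only: nth_append_left simp_thms)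
      next
        case 2
        with \<open>k < length ?P\<close> have "cd ((?P @ [R]) ! i) ((?P @ [R]) ! j) ((?P @ [R]) ! k)"
          by (simp only: nth_append_left less_trans[of _ k])
        with 2 show ?thesis by blast
      qed
    next
      case 2
      have "cd ((?P @ [R]) ! (length P - 1)) ((?P @ [R]) ! (length ?P - 1)) ((?P @ [R]) ! k)"
        using M m cd.hyps(3) 2 by (simp only: nth_append_left nth_append_length)
      then show ?thesis using M(2) m(2) 2 by blast
    qed
  qed
  then show ?case
    using P(4) Q(4) cd.hyps by (intro exI[of _ "?P @ [R]"]) (auto simp: deduced_steps_def)
qed

text \<open>With \<open>Q\<close> the target \<open>B\<^sup>*\<close>, this is the bound that strong
  elimination puts on a deduced step.\<close>

definition dn_in :: "form \<Rightarrow> form \<Rightarrow> bool" where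
  "dn_in Q F \<longleftrightarrow> (\<forall>t. \<sim>\<sim>t \<in> subforms F \<longrightarrow> (\<exists>G\<in>subforms Q. variant (\<sim>\<sim>t) G))"

definition dn_free :: "form \<Rightarrow> bool" where
  "dn_free F \<longleftrightarrow> (\<forall>t. \<sim>\<sim>t \<notin> subforms F)"

lemma dn_free_simps [simp]:
  "dn_free \<langle>v\<rangle>"
  "dn_free (a \<rightarrow> b) \<longleftrightarrow> dn_free a \<and> dn_free b"
  "dn_free (\<sim>a) \<longleftrightarrow> dn_free a \<and> (\<forall>b. a \<noteq> \<sim>b)"
  by (auto simp: dn_free_def)

lemma dn_in_simps [simp]:
  "dn_in Q \<langle>v\<rangle>"
  "dn_in Q (a \<rightarrow> b) \<longleftrightarrow> dn_in Q a \<and> dn_in Q b"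
  by (auto simp: dn_in_def)

lemma dn_in_NegD: "dn_in Q (\<sim>a) \<Longrightarrow> dn_in Q a"
  by (auto simp: dn_in_def)

lemma dn_in_if_free: "dn_free F \<Longrightarrow> dn_in Q F"
  by (auto simp: dn_in_def dn_free_def)

lemma dn_in_refl: "dn_in Q Q"
  unfolding dn_in_def using variant_refl by blast

text \<open>A substitution keeps every double negation that is already there. The bound
  \<open>dn_in\<close> lacks this stability: \<open>\<sim>\<sim>(x \<rightarrow> x)\<close> may be
  allowed while its generalisation \<open>\<sim>\<sim>(x \<rightarrow> y)\<close> is not.\<close>

lemma dn_free_if_instance: "dn_free (subst s F) \<Longrightarrow> dn_free F"
  unfolding dn_free_def using subforms_subst by fastforce

lemma dn_in_variant:
  assumes "dn_in Q F" "variant F G" shows "dn_in Q G"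
  unfolding dn_in_def
proof (intro allI impI)
  fix t assume t: "\<sim>\<sim>t \<in> subforms G"
  obtain r where r: "inj r" "subst (Var \<circ> r) F = G" using assms(2) unfolding variant_def by blast
  obtain H where H: "H \<in> subforms F" "\<sim>\<sim>t = subst (Var \<circ> r) H"
    using subforms_renaming t r(2) by metis
  have "\<exists>t'. H = \<sim>\<sim>t'"
  proof (cases H)
    case (N a)
    then show ?thesis using H(2) by (cases a) auto
  qed (use H(2) in auto)
  then obtain K where K: "K \<in> subforms Q" "variant H K"
    using assms(1) H(1) unfolding dn_in_def by blast
  have "variant H (\<sim>\<sim>t)" unfolding variant_def using r(1) H(2)[symmetric] by blast
  from variant_trans[OF variant_sym[OF this] K(2)] K(1)
  show "\<exists>G\<in>subforms Q. variant (\<sim>\<sim>t) G" ..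
qed

abbreviation D :: "form \<Rightarrow> form \<Rightarrow> bool" where
  "D Q \<equiv> der {A1, A2, A3, A4} (dn_in Q)"

text \<open>The last inference absorbs the renaming: variants of axioms are axioms, and
  \<open>cd\<close> closes its conclusions under variants.\<close>

lemma D_variant:
  assumes "D Q F" "variant F G" shows "D Q G"
proof (rule der.cases[OF assms(1)])
  fix F' assume "F = F'" "is_axiom {A1, A2, A3, A4} F'"
  then have "is_axiom {A1, A2, A3, A4} G"
    unfolding is_axiom_def using variant_trans[OF _ assms(2)] by fast
  then show ?thesis by (rule der.ax)
next
  fix M m R
  assume R: "F = R" and prems: "D Q M" "D Q m" and "cd M m R" "dn_in Q R"
  then have "cd M m G" unfolding cd_def using variant_trans[OF _ assms(2)] by fast
  moreover have "dn_in Q G" using \<open>dn_in Q R\<close> assms(2) unfolding R by (rule dn_in_variant)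
  ultimately show ?thesis by (rule der.cd[OF prems])
qed

text \<open>If the displayed unifier is most general as far as \<open>b\<close> is concerned, then condensed detachment
  yields exactly the displayed conclusion, up to renaming.\<close>

lemma D_detach:
  assumes "D Q (a \<rightarrow> b)" "D Q c" "subst \<sigma> a = subst \<tau> c"
    and mgu: "\<And>s t. subst s a = subst t c \<Longrightarrow> \<exists>\<rho>. subst s b = subst \<rho> (subst \<sigma> b)"
    and ok: "dn_in Q (subst \<sigma> b)"
  shows "D Q (subst \<sigma> b)"
proof -
  obtain s t \<rho> where R: "cd (a \<rightarrow> b) c (subst s b)" "subst s a = subst t c"
      "subst \<rho> (subst s b) = subst \<sigma> b"
    using cd_exists[OF assms(3)] by blast
  obtain \<rho>' where "subst s b = subst \<rho>' (subst \<sigma> b)" using mgu R(2) by blast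
  then have var: "variant (subst \<sigma> b) (subst s b)"
    using R(3) by (intro variant_if_instances[of \<rho>' _ _ \<rho>]) auto
  then have "dn_in Q (subst s b)" using ok dn_in_variant by blast
  with assms(1,2) R(1) have "D Q (subst s b)" by (rule der.cd)
  then show ?thesis using var variant_sym D_variant by blast
qed

text \<open>Certificate form for concrete formulas. \<open>\<sigma>\<close> and
  \<open>\<tau>\<close> exhibit a unifier, and \<open>\<rho>\<close> reads off from an arbitrary
  unifying pair \<open>s\<close>, \<open>t\<close> how it factors through the conclusion
  \<open>r\<close>. In the applications substitutions are lists indexed by variable numbers.\<close>

lemma D_detach_explicit:
  assumes "D Q (a \<rightarrow> b)" "D Q c" "subst \<sigma> a = subst \<tau> c"
    and "\<And>s t. subst s a = subst t c \<Longrightarrow> subst s b = subst (\<rho> s t) r"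
    and "subst \<sigma> b = r" "dn_free r"
  shows "D Q r"
  unfolding assms(5)[symmetric]
proof (rule D_detach[OF assms(1-3)])
  show "\<exists>\<rho>. subst s b = subst \<rho> (subst \<sigma> b)" if "subst s a = subst t c" for s t
    unfolding assms(5) using assms(4)[OF that] by blast
qed (simp add: assms(5,6) dn_in_if_free)

text \<open>The minor premiss is already an instance of \<open>a\<close>, so a unifying pair acts on
  the variables of \<open>a\<close> through \<open>t\<close> alone. The remaining variables of
  \<open>b\<close> stay independent if they go to distinct variables foreign to the minor
  premiss.\<close>

lemma D_detach_major:
  assumes "D Q (a \<rightarrow> b)" "D Q (subst \<sigma> a)"
    and fresh: "\<And>v. v \<in> vars b - vars a \<Longrightarrow> \<exists>w. \<sigma> v = \<langle>w\<rangle> \<and> w \<notin> vars (subst \<sigma> a)"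
    and inj: "inj_on \<sigma> (vars b - vars a)"
    and "dn_in Q (subst \<sigma> b)"
  shows "D Q (subst \<sigma> b)"
proof (rule D_detach[of Q a b "subst \<sigma> a" \<sigma> Var])
  fix s t assume eq: "subst s a = subst t (subst \<sigma> a)"
  \<comment> \<open>It follows \<open>t\<close> on the variables of the minor premiss and recovers
    \<open>s\<close> at the unique preimage of a fresh variable.\<close>
  let ?\<rho> = "\<lambda>w. if w \<in> vars (subst \<sigma> a) then t w else s (inv_into (vars b - vars a) \<sigma> \<langle>w\<rangle>)"
  have "s v = subst ?\<rho> (\<sigma> v)" if v: "v \<in> vars b" for v
  proof (cases "v \<in> vars a")
    case True
    then have "subst ?\<rho> (\<sigma> v) = subst t (\<sigma> v)"
      unfolding subst_eq_iff by (auto simp: vars_subst)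
    with True eq show ?thesis by (simp add: subst_subst subst_eq_iff)
  next
    case False
    then obtain w where "\<sigma> v = \<langle>w\<rangle>" "w \<notin> vars (subst \<sigma> a)" using fresh v by blast
    moreover from this have "inv_into (vars b - vars a) \<sigma> \<langle>w\<rangle> = v"
      using inj False v by (metis DiffI inv_into_f_f)
    ultimately show ?thesis by simp
  qed
  then show "\<exists>\<rho>. subst s b = subst \<rho> (subst \<sigma> b)"
    unfolding subst_subst subst_eq_iff by (intro exI[of _ ?\<rho>]) blast
qed (use assms in auto)

lemma D_detach_major_subset:
  assumes "D Q (a \<rightarrow> b)" "D Q (subst \<sigma> a)" "vars b \<subseteq> vars a" "dn_in Q (subst \<sigma> b)"
  shows "D Q (subst \<sigma> b)"
proof -
  have empty: "vars b - vars a = {}" using assms(3) by blast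
  show ?thesis by (rule D_detach_major[OF assms(1,2) _ _ assms(4)]) (simp_all only: empty empty_iff inj_on_empty)
qed

text \<open>The opposite situation: the minor premiss is the more general one, so unification
  specialises only it and leaves \<open>b\<close> untouched.\<close>

lemma D_detach_minor:
  assumes "D Q (subst \<tau> c \<rightarrow> b)" "D Q c" "dn_in Q b"
  shows "D Q b"
  using D_detach[of Q "subst \<tau> c" b c Var \<tau>] assms by auto

section \<open>Theorems with exact variable patterns\<close>

lemma D_A1: "D Q (\<langle>0\<rangle> \<rightarrow> \<langle>1\<rangle> \<rightarrow> \<langle>0\<rangle>)"
  by (rule der.ax) (auto simp: is_axiom_def A1_def x_def y_def z_def intro: variant_refl)

lemma D_A2: "D Q ((\<langle>0\<rangle> \<rightarrow> \<langle>1\<rangle>) \<rightarrow> (\<langle>1\<rangle> \<rightarrow> \<langle>2\<rangle>) \<rightarrow> \<langle>0\<rangle> \<rightarrow> \<langle>2\<rangle>)"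
  by (rule der.ax) (auto simp: is_axiom_def A2_def x_def y_def z_def intro: variant_refl)

lemma D_A3: "D Q (((\<langle>0\<rangle> \<rightarrow> \<langle>1\<rangle>) \<rightarrow> \<langle>1\<rangle>) \<rightarrow> (\<langle>1\<rangle> \<rightarrow> \<langle>0\<rangle>) \<rightarrow> \<langle>0\<rangle>)"
  by (rule der.ax) (auto simp: is_axiom_def A3_def x_def y_def z_def intro: variant_refl)

lemma D_A4: "D Q ((\<sim>\<langle>0\<rangle> \<rightarrow> \<sim>\<langle>1\<rangle>) \<rightarrow> \<langle>1\<rangle> \<rightarrow> \<langle>0\<rangle>)"
  by (rule der.ax) (auto simp: is_axiom_def A4_def x_def y_def z_def intro: variant_refl)

section \<open>Implicational laws\<close>

lemma D_weaken_ante: "D Q (((\<langle>0\<rangle> \<rightarrow> \<langle>1\<rangle>) \<rightarrow> \<langle>2\<rangle>) \<rightarrow> \<langle>1\<rangle> \<rightarrow> \<langle>2\<rangle>)"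
  by (rule D_detach_explicit[OF D_A2 D_A1, where \<sigma> = "(!) [\<langle>1\<rangle>, \<langle>0\<rangle> \<rightarrow> \<langle>1\<rangle>, \<langle>2\<rangle>]"
      and \<tau> = "(!) [\<langle>1\<rangle>, \<langle>0\<rangle>]" and \<rho> = "\<lambda>s t. (!) [t 1, t 0, s 2]"]) auto

text \<open>This is A3 with its antecedent \<open>(x \<rightarrow> y) \<rightarrow> y\<close>
  strengthened to \<open>y\<close>.\<close>

lemma D_modus_ponens: "D Q (\<langle>0\<rangle> \<rightarrow> (\<langle>0\<rangle> \<rightarrow> \<langle>1\<rangle>) \<rightarrow> \<langle>1\<rangle>)"
  by (rule D_detach_explicit[OF D_weaken_ante D_A3, where \<sigma> = "(!) [\<langle>1\<rangle> \<rightarrow> \<langle>0\<rangle>, \<langle>0\<rangle>, (\<langle>0\<rangle> \<rightarrow> \<langle>1\<rangle>) \<rightarrow> \<langle>1\<rangle>]"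
      and \<tau> = "(!) [\<langle>1\<rangle>, \<langle>0\<rangle>]" and \<rho> = "\<lambda>s t. (!) [t 1, t 0]"]) auto

lemma D_trans_ante: "D Q ((((\<langle>0\<rangle> \<rightarrow> \<langle>1\<rangle>) \<rightarrow> \<langle>2\<rangle> \<rightarrow> \<langle>1\<rangle>) \<rightarrow> \<langle>3\<rangle>) \<rightarrow> (\<langle>2\<rangle> \<rightarrow> \<langle>0\<rangle>) \<rightarrow> \<langle>3\<rangle>)"
  by (rule D_detach_explicit[OF D_A2 D_A2, where \<sigma> = "(!) [\<langle>2\<rangle> \<rightarrow> \<langle>0\<rangle>, (\<langle>0\<rangle> \<rightarrow> \<langle>1\<rangle>) \<rightarrow> \<langle>2\<rangle> \<rightarrow> \<langle>1\<rangle>, \<langle>3\<rangle>]"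
      and \<tau> = "(!) [\<langle>2\<rangle>, \<langle>0\<rangle>, \<langle>1\<rangle>]" and \<rho> = "\<lambda>s t. (!) [t 1, t 2, t 0, s 2]"]) auto

lemma D_perm: "D Q ((\<langle>0\<rangle> \<rightarrow> \<langle>1\<rangle> \<rightarrow> \<langle>2\<rangle>) \<rightarrow> \<langle>1\<rangle> \<rightarrow> \<langle>0\<rangle> \<rightarrow> \<langle>2\<rangle>)"
proof -
  have t2: "D Q ((((\<langle>0\<rangle> \<rightarrow> \<langle>1\<rangle>) \<rightarrow> \<langle>1\<rangle>) \<rightarrow> \<langle>2\<rangle>) \<rightarrow> \<langle>0\<rangle> \<rightarrow> \<langle>2\<rangle>)"
    by (rule D_detach_explicit[OF D_A2 D_modus_ponens, where \<sigma> = "(!) [\<langle>0\<rangle>, (\<langle>0\<rangle> \<rightarrow> \<langle>1\<rangle>) \<rightarrow> \<langle>1\<rangle>, \<langle>2\<rangle>]"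
        and \<tau> = "(!) [\<langle>0\<rangle>, \<langle>1\<rangle>]" and \<rho> = "\<lambda>s t. (!) [t 0, t 1, s 2]"]) auto
  show ?thesis
    by (rule D_detach_explicit[OF D_trans_ante t2, where \<sigma> = "(!) [\<langle>1\<rangle> \<rightarrow> \<langle>2\<rangle>, \<langle>2\<rangle>, \<langle>0\<rangle>, \<langle>1\<rangle> \<rightarrow> \<langle>0\<rangle> \<rightarrow> \<langle>2\<rangle>]"
        and \<tau> = "(!) [\<langle>1\<rangle>, \<langle>2\<rangle>, \<langle>0\<rangle> \<rightarrow> \<langle>2\<rangle>]" and \<rho> = "\<lambda>s t. (!) [s 2, t 0, t 1]"]) auto
qed

lemma D_const_id: "D Q (\<langle>0\<rangle> \<rightarrow> \<langle>1\<rangle> \<rightarrow> \<langle>1\<rangle>)"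
  by (rule D_detach_explicit[OF D_perm D_A1, where \<sigma> = "(!) [\<langle>1\<rangle>, \<langle>0\<rangle>, \<langle>1\<rangle>]"
      and \<tau> = "(!) [\<langle>1\<rangle>, \<langle>0\<rangle>]" and \<rho> = "\<lambda>s t. (!) [t 1, t 0]"]) auto

lemma D_id: "D Q (\<langle>0\<rangle> \<rightarrow> \<langle>0\<rangle>)"
  by (rule D_detach_explicit[OF D_const_id D_A1, where \<sigma> = "(!) [\<langle>1\<rangle> \<rightarrow> \<langle>2\<rangle> \<rightarrow> \<langle>1\<rangle>, \<langle>0\<rangle>]"
      and \<tau> = "(!) [\<langle>1\<rangle>, \<langle>2\<rangle>]" and \<rho> = "\<lambda>s t. (!) [s 1]"]) auto

lemma D_prefix: "D Q ((\<langle>0\<rangle> \<rightarrow> \<langle>1\<rangle>) \<rightarrow> (\<langle>2\<rangle> \<rightarrow> \<langle>0\<rangle>) \<rightarrow> \<langle>2\<rangle> \<rightarrow> \<langle>1\<rangle>)"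
  by (rule D_detach_explicit[OF D_perm D_A2, where \<sigma> = "(!) [\<langle>2\<rangle> \<rightarrow> \<langle>0\<rangle>, \<langle>0\<rangle> \<rightarrow> \<langle>1\<rangle>, \<langle>2\<rangle> \<rightarrow> \<langle>1\<rangle>]"
      and \<tau> = "(!) [\<langle>2\<rangle>, \<langle>0\<rangle>, \<langle>1\<rangle>]" and \<rho> = "\<lambda>s t. (!) [t 1, t 2, t 0]"]) auto

section \<open>Negation and contraposition\<close>

lemma D_efq: "D Q (\<sim>\<langle>0\<rangle> \<rightarrow> \<langle>0\<rangle> \<rightarrow> \<langle>1\<rangle>)"
  by (rule D_detach_explicit[OF D_weaken_ante D_A4, where \<sigma> = "(!) [\<sim>\<langle>1\<rangle>, \<sim>\<langle>0\<rangle>, \<langle>0\<rangle> \<rightarrow> \<langle>1\<rangle>]"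
      and \<tau> = "(!) [\<langle>1\<rangle>, \<langle>0\<rangle>]" and \<rho> = "\<lambda>s t. (!) [t 1, t 0]"]) auto

text \<open>The formula \<open>\<sim>(p \<rightarrow> p)\<close> serves as falsum. In A4 it arises
  by taking \<open>p \<rightarrow> p\<close> for the formula whose truth is then discharged by
  identity.\<close>

lemma D_refute: "D Q ((\<sim>\<langle>0\<rangle> \<rightarrow> \<sim>(\<langle>1\<rangle> \<rightarrow> \<langle>1\<rangle>)) \<rightarrow> \<langle>0\<rangle>)"
proof -
  have t13: "D Q (\<langle>0\<rangle> \<rightarrow> (\<sim>\<langle>1\<rangle> \<rightarrow> \<sim>\<langle>0\<rangle>) \<rightarrow> \<langle>1\<rangle>)"
    by (rule D_detach_explicit[OF D_perm D_A4, where \<sigma> = "(!) [\<sim>\<langle>1\<rangle> \<rightarrow> \<sim>\<langle>0\<rangle>, \<langle>0\<rangle>, \<langle>1\<rangle>]"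
        and \<tau> = "(!) [\<langle>1\<rangle>, \<langle>0\<rangle>]" and \<rho> = "\<lambda>s t. (!) [t 1, t 0]"]) auto
  show ?thesis
    by (rule D_detach_explicit[OF t13 D_id, where \<sigma> = "(!) [\<langle>1\<rangle> \<rightarrow> \<langle>1\<rangle>, \<langle>0\<rangle>]"
        and \<tau> = "(!) [\<langle>1\<rangle>]" and \<rho> = "\<lambda>s t. (!) [s 1, t 0]"]) auto
qed

lemma D_neg_intro: "D Q ((\<langle>0\<rangle> \<rightarrow> \<langle>1\<rangle> \<rightarrow> \<sim>(\<langle>2\<rangle> \<rightarrow> \<langle>2\<rangle>)) \<rightarrow> \<langle>0\<rangle> \<rightarrow> \<sim>\<langle>1\<rangle>)"
proof -
  have t15: "D Q ((\<langle>0\<rangle> \<rightarrow> \<langle>1\<rangle>) \<rightarrow> (\<sim>\<langle>0\<rangle> \<rightarrow> \<sim>(\<langle>2\<rangle> \<rightarrow> \<langle>2\<rangle>)) \<rightarrow> \<langle>1\<rangle>)"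
    by (rule D_detach_explicit[OF D_A2 D_refute, where \<sigma> = "(!) [\<sim>\<langle>0\<rangle> \<rightarrow> \<sim>(\<langle>2\<rangle> \<rightarrow> \<langle>2\<rangle>), \<langle>0\<rangle>, \<langle>1\<rangle>]"
        and \<tau> = "(!) [\<langle>0\<rangle>, \<langle>2\<rangle>]" and \<rho> = "\<lambda>s t. (!) [t 0, s 2, t 1]"]) auto
  have t16: "D Q ((((\<sim>\<langle>0\<rangle> \<rightarrow> \<sim>(\<langle>1\<rangle> \<rightarrow> \<langle>1\<rangle>)) \<rightarrow> \<langle>2\<rangle>) \<rightarrow> \<langle>3\<rangle>) \<rightarrow> (\<langle>0\<rangle> \<rightarrow> \<langle>2\<rangle>) \<rightarrow> \<langle>3\<rangle>)"
    by (rule D_detach_explicit[OF D_A2 t15, where \<sigma> = "(!) [\<langle>0\<rangle> \<rightarrow> \<langle>2\<rangle>, (\<sim>\<langle>0\<rangle> \<rightarrow> \<sim>(\<langle>1\<rangle> \<rightarrow> \<langle>1\<rangle>)) \<rightarrow> \<langle>2\<rangle>, \<langle>3\<rangle>]"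
        and \<tau> = "(!) [\<langle>0\<rangle>, \<langle>2\<rangle>, \<langle>1\<rangle>]" and \<rho> = "\<lambda>s t. (!) [t 0, t 2, t 1, s 2]"]) auto
  have t11: "D Q ((\<langle>0\<rangle> \<rightarrow> \<langle>1\<rangle>) \<rightarrow> ((\<langle>1\<rangle> \<rightarrow> \<langle>0\<rangle>) \<rightarrow> \<langle>0\<rangle>) \<rightarrow> \<langle>1\<rangle>)"
    by (rule D_detach_explicit[OF D_perm D_A3, where \<sigma> = "(!) [(\<langle>1\<rangle> \<rightarrow> \<langle>0\<rangle>) \<rightarrow> \<langle>0\<rangle>, \<langle>0\<rangle> \<rightarrow> \<langle>1\<rangle>, \<langle>1\<rangle>]"
        and \<tau> = "(!) [\<langle>1\<rangle>, \<langle>0\<rangle>]" and \<rho> = "\<lambda>s t. (!) [t 1, t 0]"]) auto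
  have t9: "D Q (\<langle>0\<rangle> \<rightarrow> \<sim>\<langle>0\<rangle> \<rightarrow> \<langle>1\<rangle>)"
    by (rule D_detach_explicit[OF D_perm D_efq, where \<sigma> = "(!) [\<sim>\<langle>0\<rangle>, \<langle>0\<rangle>, \<langle>1\<rangle>]"
        and \<tau> = "(!) [\<langle>0\<rangle>, \<langle>1\<rangle>]" and \<rho> = "\<lambda>s t. (!) [t 0, t 1]"]) auto
  have t10: "D Q (\<sim>(\<langle>0\<rangle> \<rightarrow> \<langle>0\<rangle>) \<rightarrow> \<langle>1\<rangle>)"
    by (rule D_detach_explicit[OF t9 D_id, where \<sigma> = "(!) [\<langle>0\<rangle> \<rightarrow> \<langle>0\<rangle>, \<langle>1\<rangle>]"
        and \<tau> = "(!) [\<langle>0\<rangle>]" and \<rho> = "\<lambda>s t. (!) [t 0, s 1]"]) auto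
  \<comment> \<open>Double negation elimination with negation written as implication of falsum, so
    that no forbidden subformula appears; it is A3 applied to falsum, which implies
    everything.\<close>
  have t12: "D Q (((\<langle>0\<rangle> \<rightarrow> \<sim>(\<langle>1\<rangle> \<rightarrow> \<langle>1\<rangle>)) \<rightarrow> \<sim>(\<langle>1\<rangle> \<rightarrow> \<langle>1\<rangle>)) \<rightarrow> \<langle>0\<rangle>)"
    by (rule D_detach_explicit[OF t11 t10, where \<sigma> = "(!) [\<sim>(\<langle>1\<rangle> \<rightarrow> \<langle>1\<rangle>), \<langle>0\<rangle>]"
        and \<tau> = "(!) [\<langle>1\<rangle>, \<langle>0\<rangle>]" and \<rho> = "\<lambda>s t. (!) [t 1, t 0]"]) auto
  \<comment> \<open>If \<open>x\<close> implies falsum then, by \<open>D_refute\<close>, so does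
    \<open>\<sim>x \<rightarrow> falsum\<close>; now \<open>t12\<close> at \<open>\<sim>x\<close>
    gives \<open>\<sim>x\<close>.\<close>
  have t17: "D Q ((\<langle>0\<rangle> \<rightarrow> \<sim>(\<langle>1\<rangle> \<rightarrow> \<langle>1\<rangle>)) \<rightarrow> \<sim>\<langle>0\<rangle>)"
    by (rule D_detach_explicit[OF t16 t12, where \<sigma> = "(!) [\<langle>0\<rangle>, \<langle>1\<rangle>, \<sim>(\<langle>1\<rangle> \<rightarrow> \<langle>1\<rangle>), \<sim>\<langle>0\<rangle>]"
        and \<tau> = "(!) [\<sim>\<langle>0\<rangle>, \<langle>1\<rangle>]" and \<rho> = "\<lambda>s t. (!) [s 0, t 1]"]) auto
  show ?thesis
    by (rule D_detach_explicit[OF D_prefix t17, where \<sigma> = "(!) [\<langle>1\<rangle> \<rightarrow> \<sim>(\<langle>2\<rangle> \<rightarrow> \<langle>2\<rangle>), \<sim>\<langle>1\<rangle>, \<langle>0\<rangle>]"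
        and \<tau> = "(!) [\<langle>1\<rangle>, \<langle>2\<rangle>]" and \<rho> = "\<lambda>s t. (!) [s 2, t 0, t 1]"]) auto
qed

lemma D_efq_ante: "D Q (((\<langle>0\<rangle> \<rightarrow> \<langle>1\<rangle>) \<rightarrow> \<langle>2\<rangle>) \<rightarrow> \<sim>\<langle>0\<rangle> \<rightarrow> \<langle>2\<rangle>)"
  by (rule D_detach_explicit[OF D_A2 D_efq, where \<sigma> = "(!) [\<sim>\<langle>0\<rangle>, \<langle>0\<rangle> \<rightarrow> \<langle>1\<rangle>, \<langle>2\<rangle>]"
      and \<tau> = "(!) [\<langle>0\<rangle>, \<langle>1\<rangle>]" and \<rho> = "\<lambda>s t. (!) [t 0, t 1, s 2]"]) auto

text \<open>Transitivity into falsum gives the law with \<open>y \<rightarrow> falsum\<close> in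
  place of \<open>\<sim>y\<close>; \<open>D_efq_ante\<close> replaces that antecedent by
  \<open>\<sim>y\<close>, and the auxiliary variable of falsum disappears.\<close>

lemma D_contrapos: "D Q ((\<langle>0\<rangle> \<rightarrow> \<langle>1\<rangle>) \<rightarrow> \<sim>\<langle>1\<rangle> \<rightarrow> \<sim>\<langle>0\<rangle>)"
proof -
  have t19: "D Q ((\<langle>0\<rangle> \<rightarrow> \<langle>1\<rangle>) \<rightarrow> (\<langle>1\<rangle> \<rightarrow> \<sim>(\<langle>2\<rangle> \<rightarrow> \<langle>2\<rangle>)) \<rightarrow> \<sim>\<langle>0\<rangle>)"
    by (rule D_detach_explicit[OF D_trans_ante D_neg_intro, where \<sigma> = "(!) [\<langle>1\<rangle>, \<sim>(\<langle>2\<rangle> \<rightarrow> \<langle>2\<rangle>), \<langle>0\<rangle>, (\<langle>1\<rangle> \<rightarrow> \<sim>(\<langle>2\<rangle> \<rightarrow> \<langle>2\<rangle>)) \<rightarrow> \<sim>\<langle>0\<rangle>]"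
        and \<tau> = "(!) [\<langle>1\<rangle> \<rightarrow> \<sim>(\<langle>2\<rangle> \<rightarrow> \<langle>2\<rangle>), \<langle>0\<rangle>, \<langle>2\<rangle>]" and \<rho> = "\<lambda>s t. (!) [t 1, s 0, t 2]"]) auto
  have t21: "D Q ((((\<langle>0\<rangle> \<rightarrow> \<sim>(\<langle>1\<rangle> \<rightarrow> \<langle>1\<rangle>)) \<rightarrow> \<sim>\<langle>2\<rangle>) \<rightarrow> \<langle>3\<rangle>) \<rightarrow> (\<langle>2\<rangle> \<rightarrow> \<langle>0\<rangle>) \<rightarrow> \<langle>3\<rangle>)"
    by (rule D_detach_explicit[OF D_A2 t19, where \<sigma> = "(!) [\<langle>2\<rangle> \<rightarrow> \<langle>0\<rangle>, (\<langle>0\<rangle> \<rightarrow> \<sim>(\<langle>1\<rangle> \<rightarrow> \<langle>1\<rangle>)) \<rightarrow> \<sim>\<langle>2\<rangle>, \<langle>3\<rangle>]"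
        and \<tau> = "(!) [\<langle>2\<rangle>, \<langle>0\<rangle>, \<langle>1\<rangle>]" and \<rho> = "\<lambda>s t. (!) [t 1, t 2, t 0, s 2]"]) auto
  show ?thesis
    by (rule D_detach_explicit[OF t21 D_efq_ante, where \<sigma> = "(!) [\<langle>1\<rangle>, \<langle>2\<rangle>, \<langle>0\<rangle>, \<sim>\<langle>1\<rangle> \<rightarrow> \<sim>\<langle>0\<rangle>]"
        and \<tau> = "(!) [\<langle>1\<rangle>, \<sim>(\<langle>2\<rangle> \<rightarrow> \<langle>2\<rangle>), \<sim>\<langle>0\<rangle>]" and \<rho> = "\<lambda>s t. (!) [s 2, t 0]"]) auto
qed

lemma D_contrapos_left: "D Q ((\<sim>\<langle>0\<rangle> \<rightarrow> \<langle>1\<rangle>) \<rightarrow> \<sim>\<langle>1\<rangle> \<rightarrow> \<langle>0\<rangle>)"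
proof -
  have t23: "D Q ((\<langle>0\<rangle> \<rightarrow> \<sim>\<langle>1\<rangle> \<rightarrow> \<sim>(\<langle>2\<rangle> \<rightarrow> \<langle>2\<rangle>)) \<rightarrow> \<langle>0\<rangle> \<rightarrow> \<langle>1\<rangle>)"
    by (rule D_detach_explicit[OF D_prefix D_refute, where \<sigma> = "(!) [\<sim>\<langle>1\<rangle> \<rightarrow> \<sim>(\<langle>2\<rangle> \<rightarrow> \<langle>2\<rangle>), \<langle>1\<rangle>, \<langle>0\<rangle>]"
        and \<tau> = "(!) [\<langle>1\<rangle>, \<langle>2\<rangle>]" and \<rho> = "\<lambda>s t. (!) [s 2, t 0, t 1]"]) auto
  have t24: "D Q ((\<sim>\<langle>0\<rangle> \<rightarrow> \<langle>1\<rangle>) \<rightarrow> (\<langle>1\<rangle> \<rightarrow> \<sim>(\<langle>2\<rangle> \<rightarrow> \<langle>2\<rangle>)) \<rightarrow> \<langle>0\<rangle>)"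
    by (rule D_detach_explicit[OF D_trans_ante t23, where \<sigma> = "(!) [\<langle>1\<rangle>, \<sim>(\<langle>2\<rangle> \<rightarrow> \<langle>2\<rangle>), \<sim>\<langle>0\<rangle>, (\<langle>1\<rangle> \<rightarrow> \<sim>(\<langle>2\<rangle> \<rightarrow> \<langle>2\<rangle>)) \<rightarrow> \<langle>0\<rangle>]"
        and \<tau> = "(!) [\<langle>1\<rangle> \<rightarrow> \<sim>(\<langle>2\<rangle> \<rightarrow> \<langle>2\<rangle>), \<langle>0\<rangle>, \<langle>2\<rangle>]" and \<rho> = "\<lambda>s t. (!) [t 1, s 0, t 2]"]) auto
  have t25: "D Q ((((\<langle>0\<rangle> \<rightarrow> \<sim>(\<langle>1\<rangle> \<rightarrow> \<langle>1\<rangle>)) \<rightarrow> \<langle>2\<rangle>) \<rightarrow> \<langle>3\<rangle>) \<rightarrow> (\<sim>\<langle>2\<rangle> \<rightarrow> \<langle>0\<rangle>) \<rightarrow> \<langle>3\<rangle>)"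
    by (rule D_detach_explicit[OF D_A2 t24, where \<sigma> = "(!) [\<sim>\<langle>2\<rangle> \<rightarrow> \<langle>0\<rangle>, (\<langle>0\<rangle> \<rightarrow> \<sim>(\<langle>1\<rangle> \<rightarrow> \<langle>1\<rangle>)) \<rightarrow> \<langle>2\<rangle>, \<langle>3\<rangle>]"
        and \<tau> = "(!) [\<langle>2\<rangle>, \<langle>0\<rangle>, \<langle>1\<rangle>]" and \<rho> = "\<lambda>s t. (!) [t 1, t 2, t 0, s 2]"]) auto
  show ?thesis
    by (rule D_detach_explicit[OF t25 D_efq_ante, where \<sigma> = "(!) [\<langle>1\<rangle>, \<langle>2\<rangle>, \<langle>0\<rangle>, \<sim>\<langle>1\<rangle> \<rightarrow> \<langle>0\<rangle>]"
        and \<tau> = "(!) [\<langle>1\<rangle>, \<sim>(\<langle>2\<rangle> \<rightarrow> \<langle>2\<rangle>), \<langle>0\<rangle>]" and \<rho> = "\<lambda>s t. (!) [t 2, t 0]"]) auto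
qed

lemma D_contrapos_right: "D Q ((\<langle>0\<rangle> \<rightarrow> \<sim>\<langle>1\<rangle>) \<rightarrow> \<langle>1\<rangle> \<rightarrow> \<sim>\<langle>0\<rangle>)"
proof -
  have t27: "D Q ((\<langle>0\<rangle> \<rightarrow> \<sim>\<langle>1\<rangle>) \<rightarrow> \<langle>0\<rangle> \<rightarrow> \<langle>1\<rangle> \<rightarrow> \<langle>2\<rangle>)"
    by (rule D_detach_explicit[OF D_prefix D_efq, where \<sigma> = "(!) [\<sim>\<langle>1\<rangle>, \<langle>1\<rangle> \<rightarrow> \<langle>2\<rangle>, \<langle>0\<rangle>]"
        and \<tau> = "(!) [\<langle>1\<rangle>, \<langle>2\<rangle>]" and \<rho> = "\<lambda>s t. (!) [s 2, t 0, t 1]"]) auto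
  have t28: "D Q (((\<langle>0\<rangle> \<rightarrow> \<langle>1\<rangle> \<rightarrow> \<langle>2\<rangle>) \<rightarrow> \<langle>3\<rangle>) \<rightarrow> (\<langle>0\<rangle> \<rightarrow> \<sim>\<langle>1\<rangle>) \<rightarrow> \<langle>3\<rangle>)"
    by (rule D_detach_explicit[OF D_A2 t27, where \<sigma> = "(!) [\<langle>0\<rangle> \<rightarrow> \<sim>\<langle>1\<rangle>, \<langle>0\<rangle> \<rightarrow> \<langle>1\<rangle> \<rightarrow> \<langle>2\<rangle>, \<langle>3\<rangle>]"
        and \<tau> = "(!) [\<langle>0\<rangle>, \<langle>1\<rangle>, \<langle>2\<rangle>]" and \<rho> = "\<lambda>s t. (!) [t 0, t 1, t 2, s 2]"]) auto
  have t29: "D Q ((\<langle>0\<rangle> \<rightarrow> \<sim>\<langle>1\<rangle>) \<rightarrow> \<langle>1\<rangle> \<rightarrow> \<langle>0\<rangle> \<rightarrow> \<langle>2\<rangle>)"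
    by (rule D_detach_explicit[OF t28 D_perm, where \<sigma> = "(!) [\<langle>0\<rangle>, \<langle>1\<rangle>, \<langle>2\<rangle>, \<langle>1\<rangle> \<rightarrow> \<langle>0\<rangle> \<rightarrow> \<langle>2\<rangle>]"
        and \<tau> = "(!) [\<langle>0\<rangle>, \<langle>1\<rangle>, \<langle>2\<rangle>]" and \<rho> = "\<lambda>s t. (!) [t 0, t 1, t 2]"]) auto
  have t30: "D Q (((\<langle>0\<rangle> \<rightarrow> \<langle>1\<rangle> \<rightarrow> \<langle>2\<rangle>) \<rightarrow> \<langle>3\<rangle>) \<rightarrow> (\<langle>1\<rangle> \<rightarrow> \<sim>\<langle>0\<rangle>) \<rightarrow> \<langle>3\<rangle>)"
    by (rule D_detach_explicit[OF D_A2 t29, where \<sigma> = "(!) [\<langle>1\<rangle> \<rightarrow> \<sim>\<langle>0\<rangle>, \<langle>0\<rangle> \<rightarrow> \<langle>1\<rangle> \<rightarrow> \<langle>2\<rangle>, \<langle>3\<rangle>]"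
        and \<tau> = "(!) [\<langle>1\<rangle>, \<langle>0\<rangle>, \<langle>2\<rangle>]" and \<rho> = "\<lambda>s t. (!) [t 1, t 0, t 2, s 2]"]) auto
  show ?thesis
    by (rule D_detach_explicit[OF t30 D_neg_intro, where \<sigma> = "(!) [\<langle>1\<rangle>, \<langle>0\<rangle>, \<sim>(\<langle>2\<rangle> \<rightarrow> \<langle>2\<rangle>), \<langle>1\<rangle> \<rightarrow> \<sim>\<langle>0\<rangle>]"
        and \<tau> = "(!) [\<langle>1\<rangle>, \<langle>0\<rangle>, \<langle>2\<rangle>]" and \<rho> = "\<lambda>s t. (!) [t 1, t 0]"]) auto
qed

section \<open>Laws for tags, premisses of the form p \<rightarrow> p\<close>

lemma D_top_ante: "D Q ((\<langle>0\<rangle> \<rightarrow> \<langle>1\<rangle>) \<rightarrow> ((\<langle>2\<rangle> \<rightarrow> \<langle>2\<rangle>) \<rightarrow> \<langle>0\<rangle>) \<rightarrow> \<langle>1\<rangle>)"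
proof -
  have t32: "D Q (((\<langle>0\<rangle> \<rightarrow> \<langle>0\<rangle>) \<rightarrow> \<langle>1\<rangle>) \<rightarrow> \<langle>1\<rangle>)"
    by (rule D_detach_explicit[OF D_modus_ponens D_id, where \<sigma> = "(!) [\<langle>0\<rangle> \<rightarrow> \<langle>0\<rangle>, \<langle>1\<rangle>]"
        and \<tau> = "(!) [\<langle>0\<rangle>]" and \<rho> = "\<lambda>s t. (!) [t 0, s 1]"]) auto
  show ?thesis
    by (rule D_detach_explicit[OF D_A2 t32, where \<sigma> = "(!) [(\<langle>2\<rangle> \<rightarrow> \<langle>2\<rangle>) \<rightarrow> \<langle>0\<rangle>, \<langle>0\<rangle>, \<langle>1\<rangle>]"
        and \<tau> = "(!) [\<langle>2\<rangle>, \<langle>0\<rangle>]" and \<rho> = "\<lambda>s t. (!) [t 1, s 2, t 0]"]) auto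
qed

text \<open>Identifying variables: if \<open>a \<rightarrow> b\<close> is a theorem and \<open>\<sigma>\<close> unifies \<open>a\<close> with \<open>b\<close>, then \<open>a\<sigma> \<rightarrow> a\<sigma>\<close> is
  a theorem with exactly these variables. For \<open>t = p \<rightarrow> p\<close>, detaching \<open>(t \<rightarrow> a) \<rightarrow> b\<close> from axiom A3 unifies
  \<open>a\<close> with \<open>b\<close> and yields \<open>(a\<sigma> \<rightarrow> t) \<rightarrow> t\<close>; detaching this from A3 yields \<open>(t \<rightarrow> a\<sigma>) \<rightarrow> a\<sigma>\<close>, and \<open>t\<close> can
  be dropped. Here \<open>a \<rightarrow> b\<close> is \<open>y \<rightarrow> (x \<rightarrow> x)\<close>, for which the second use of A3 is only a renaming.\<close>

lemma D_tag_refl: "D Q ((\<langle>0\<rangle> \<rightarrow> \<langle>0\<rangle>) \<rightarrow> \<langle>0\<rangle> \<rightarrow> \<langle>0\<rangle>)"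
proof -
  have t34: "D Q (((\<langle>0\<rangle> \<rightarrow> \<langle>0\<rangle>) \<rightarrow> \<langle>1\<rangle>) \<rightarrow> \<langle>2\<rangle> \<rightarrow> \<langle>2\<rangle>)"
    by (rule D_detach_explicit[OF D_top_ante D_const_id, where \<sigma> = "(!) [\<langle>1\<rangle>, \<langle>2\<rangle> \<rightarrow> \<langle>2\<rangle>, \<langle>0\<rangle>]"
        and \<tau> = "(!) [\<langle>1\<rangle>, \<langle>2\<rangle>]" and \<rho> = "\<lambda>s t. (!) [s 2, t 0, t 1]"]) auto
  have t35: "D Q (((\<langle>0\<rangle> \<rightarrow> \<langle>0\<rangle>) \<rightarrow> \<langle>1\<rangle> \<rightarrow> \<langle>1\<rangle>) \<rightarrow> \<langle>1\<rangle> \<rightarrow> \<langle>1\<rangle>)"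
    by (rule D_detach_explicit[OF D_A3 t34, where \<sigma> = "(!) [\<langle>1\<rangle> \<rightarrow> \<langle>1\<rangle>, \<langle>0\<rangle> \<rightarrow> \<langle>0\<rangle>]"
        and \<tau> = "(!) [\<langle>1\<rangle>, \<langle>0\<rangle> \<rightarrow> \<langle>0\<rangle>, \<langle>0\<rangle>]" and \<rho> = "\<lambda>s t. (!) [t 2, t 0]"]) auto
  show ?thesis
    by (rule D_detach_explicit[OF D_weaken_ante t35, where \<sigma> = "(!) [\<langle>1\<rangle> \<rightarrow> \<langle>1\<rangle>, \<langle>0\<rangle> \<rightarrow> \<langle>0\<rangle>, \<langle>0\<rangle> \<rightarrow> \<langle>0\<rangle>]"
        and \<tau> = "(!) [\<langle>1\<rangle>, \<langle>0\<rangle>]" and \<rho> = "\<lambda>s t. (!) [t 1]"]) auto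
qed

text \<open>Logically just an instance of identity, and likewise \<open>D_tag_weaken\<close> of A1
  and \<open>D_tag_prefix\<close> of \<open>D_prefix\<close>. What matters is the exact pattern:
  detaching from this formula turns an arbitrary first antecedent into a tag.\<close>

lemma D_tag_restrict: "D Q (((\<langle>0\<rangle> \<rightarrow> \<langle>0\<rangle>) \<rightarrow> \<langle>1\<rangle>) \<rightarrow> (\<langle>0\<rangle> \<rightarrow> \<langle>0\<rangle>) \<rightarrow> \<langle>1\<rangle>)"
  by (rule D_detach_explicit[OF D_A2 D_tag_refl, where \<sigma> = "(!) [\<langle>0\<rangle> \<rightarrow> \<langle>0\<rangle>, \<langle>0\<rangle> \<rightarrow> \<langle>0\<rangle>, \<langle>1\<rangle>]"
      and \<tau> = "(!) [\<langle>0\<rangle>]" and \<rho> = "\<lambda>s t. (!) [t 0, s 2]"]) auto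

lemma D_tag_weaken: "D Q (\<langle>0\<rangle> \<rightarrow> (\<langle>1\<rangle> \<rightarrow> \<langle>1\<rangle>) \<rightarrow> \<langle>0\<rangle>)"
  by (rule D_detach_explicit[OF D_weaken_ante D_tag_restrict, where \<sigma> = "(!) [\<langle>1\<rangle> \<rightarrow> \<langle>1\<rangle>, \<langle>0\<rangle>, (\<langle>1\<rangle> \<rightarrow> \<langle>1\<rangle>) \<rightarrow> \<langle>0\<rangle>]"
      and \<tau> = "(!) [\<langle>1\<rangle>, \<langle>0\<rangle>]" and \<rho> = "\<lambda>s t. (!) [t 1, t 0]"]) auto

lemma D_tag_weaken_inner: "D Q ((\<langle>0\<rangle> \<rightarrow> \<langle>1\<rangle>) \<rightarrow> \<langle>0\<rangle> \<rightarrow> (\<langle>2\<rangle> \<rightarrow> \<langle>2\<rangle>) \<rightarrow> \<langle>1\<rangle>)"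
  by (rule D_detach_explicit[OF D_prefix D_tag_weaken, where \<sigma> = "(!) [\<langle>1\<rangle>, (\<langle>2\<rangle> \<rightarrow> \<langle>2\<rangle>) \<rightarrow> \<langle>1\<rangle>, \<langle>0\<rangle>]"
      and \<tau> = "(!) [\<langle>1\<rangle>, \<langle>2\<rangle>]" and \<rho> = "\<lambda>s t. (!) [s 2, t 0, t 1]"]) auto

lemma D_prefix_ante: "D Q ((((\<langle>0\<rangle> \<rightarrow> \<langle>1\<rangle>) \<rightarrow> \<langle>0\<rangle> \<rightarrow> \<langle>2\<rangle>) \<rightarrow> \<langle>3\<rangle>) \<rightarrow> (\<langle>1\<rangle> \<rightarrow> \<langle>2\<rangle>) \<rightarrow> \<langle>3\<rangle>)"
  by (rule D_detach_explicit[OF D_A2 D_prefix, where \<sigma> = "(!) [\<langle>1\<rangle> \<rightarrow> \<langle>2\<rangle>, (\<langle>0\<rangle> \<rightarrow> \<langle>1\<rangle>) \<rightarrow> \<langle>0\<rangle> \<rightarrow> \<langle>2\<rangle>, \<langle>3\<rangle>]"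
      and \<tau> = "(!) [\<langle>1\<rangle>, \<langle>2\<rangle>, \<langle>0\<rangle>]" and \<rho> = "\<lambda>s t. (!) [t 2, t 0, t 1, s 2]"]) auto

lemma D_tag_prefix: "D Q ((\<langle>0\<rangle> \<rightarrow> \<langle>1\<rangle>) \<rightarrow> ((\<langle>2\<rangle> \<rightarrow> \<langle>2\<rangle>) \<rightarrow> \<langle>0\<rangle>) \<rightarrow> (\<langle>2\<rangle> \<rightarrow> \<langle>2\<rangle>) \<rightarrow> \<langle>1\<rangle>)"
proof -
  have t40: "D Q ((\<langle>0\<rangle> \<rightarrow> (\<langle>1\<rangle> \<rightarrow> \<langle>1\<rangle>) \<rightarrow> \<langle>2\<rangle>) \<rightarrow> \<langle>0\<rangle> \<rightarrow> (\<langle>1\<rangle> \<rightarrow> \<langle>1\<rangle>) \<rightarrow> \<langle>2\<rangle>)"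
    by (rule D_detach_explicit[OF D_prefix D_tag_restrict, where \<sigma> = "(!) [(\<langle>1\<rangle> \<rightarrow> \<langle>1\<rangle>) \<rightarrow> \<langle>2\<rangle>, (\<langle>1\<rangle> \<rightarrow> \<langle>1\<rangle>) \<rightarrow> \<langle>2\<rangle>, \<langle>0\<rangle>]"
        and \<tau> = "(!) [\<langle>1\<rangle>, \<langle>2\<rangle>]" and \<rho> = "\<lambda>s t. (!) [s 2, t 0, t 1]"]) auto
  show ?thesis
    by (rule D_detach_explicit[OF D_prefix_ante t40, where \<sigma> = "(!) [\<langle>2\<rangle> \<rightarrow> \<langle>2\<rangle>, \<langle>0\<rangle>, \<langle>1\<rangle>, ((\<langle>2\<rangle> \<rightarrow> \<langle>2\<rangle>) \<rightarrow> \<langle>0\<rangle>) \<rightarrow> (\<langle>2\<rangle> \<rightarrow> \<langle>2\<rangle>) \<rightarrow> \<langle>1\<rangle>]"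
        and \<tau> = "(!) [(\<langle>2\<rangle> \<rightarrow> \<langle>2\<rangle>) \<rightarrow> \<langle>0\<rangle>, \<langle>2\<rangle>, \<langle>1\<rangle>]" and \<rho> = "\<lambda>s t. (!) [s 1, t 2, t 1]"]) auto
qed

lemma D_imp_mono: "D Q ((\<langle>0\<rangle> \<rightarrow> \<langle>1\<rangle>) \<rightarrow> (\<langle>2\<rangle> \<rightarrow> \<langle>3\<rangle>) \<rightarrow> (\<langle>1\<rangle> \<rightarrow> \<langle>2\<rangle>) \<rightarrow> \<langle>0\<rangle> \<rightarrow> \<langle>3\<rangle>)"
proof -
  have t43: "D Q ((\<langle>0\<rangle> \<rightarrow> \<langle>1\<rangle> \<rightarrow> \<langle>2\<rangle>) \<rightarrow> (\<langle>2\<rangle> \<rightarrow> \<langle>3\<rangle>) \<rightarrow> \<langle>0\<rangle> \<rightarrow> \<langle>1\<rangle> \<rightarrow> \<langle>3\<rangle>)"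
    by (rule D_detach_explicit[OF D_trans_ante D_prefix_ante, where \<sigma> = "(!) [\<langle>1\<rangle> \<rightarrow> \<langle>2\<rangle>, \<langle>1\<rangle> \<rightarrow> \<langle>3\<rangle>, \<langle>0\<rangle>, (\<langle>2\<rangle> \<rightarrow> \<langle>3\<rangle>) \<rightarrow> \<langle>0\<rangle> \<rightarrow> \<langle>1\<rangle> \<rightarrow> \<langle>3\<rangle>]"
        and \<tau> = "(!) [\<langle>1\<rangle>, \<langle>2\<rangle>, \<langle>3\<rangle>, \<langle>0\<rangle> \<rightarrow> \<langle>1\<rangle> \<rightarrow> \<langle>3\<rangle>]" and \<rho> = "\<lambda>s t. (!) [s 2, t 0, t 1, t 2]"]) auto
  show ?thesis
    by (rule D_detach_explicit[OF D_trans_ante t43, where \<sigma> = "(!) [\<langle>1\<rangle>, \<langle>2\<rangle>, \<langle>0\<rangle>, (\<langle>2\<rangle> \<rightarrow> \<langle>3\<rangle>) \<rightarrow> (\<langle>1\<rangle> \<rightarrow> \<langle>2\<rangle>) \<rightarrow> \<langle>0\<rangle> \<rightarrow> \<langle>3\<rangle>]"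
        and \<tau> = "(!) [\<langle>1\<rangle> \<rightarrow> \<langle>2\<rangle>, \<langle>0\<rangle>, \<langle>2\<rangle>, \<langle>3\<rangle>]" and \<rho> = "\<lambda>s t. (!) [t 1, s 0, t 2, t 3]"]) auto
qed

text \<open>The same method, applied to the permutation of two antecedents of the form \<open>p \<rightarrow> p\<close>.\<close>

lemma D_tag_contract: "D Q (((\<langle>0\<rangle> \<rightarrow> \<langle>0\<rangle>) \<rightarrow> (\<langle>0\<rangle> \<rightarrow> \<langle>0\<rangle>) \<rightarrow> \<langle>1\<rangle>) \<rightarrow> (\<langle>0\<rangle> \<rightarrow> \<langle>0\<rangle>) \<rightarrow> \<langle>1\<rangle>)"
proof -
  have t45: "D Q ((((\<langle>0\<rangle> \<rightarrow> \<langle>0\<rangle>) \<rightarrow> \<langle>1\<rangle>) \<rightarrow> \<langle>2\<rangle>) \<rightarrow> ((\<langle>0\<rangle> \<rightarrow> \<langle>0\<rangle>) \<rightarrow> \<langle>1\<rangle>) \<rightarrow> \<langle>2\<rangle>)"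
    by (rule D_detach_explicit[OF D_A2 D_tag_restrict, where \<sigma> = "(!) [(\<langle>0\<rangle> \<rightarrow> \<langle>0\<rangle>) \<rightarrow> \<langle>1\<rangle>, (\<langle>0\<rangle> \<rightarrow> \<langle>0\<rangle>) \<rightarrow> \<langle>1\<rangle>, \<langle>2\<rangle>]"
        and \<tau> = "(!) [\<langle>0\<rangle>, \<langle>1\<rangle>]" and \<rho> = "\<lambda>s t. (!) [t 0, t 1, s 2]"]) auto
  have t46: "D Q (((\<langle>0\<rangle> \<rightarrow> \<langle>0\<rangle>) \<rightarrow> \<langle>1\<rangle> \<rightarrow> \<langle>2\<rangle>) \<rightarrow> \<langle>1\<rangle> \<rightarrow> (\<langle>0\<rangle> \<rightarrow> \<langle>0\<rangle>) \<rightarrow> \<langle>2\<rangle>)"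
    by (rule D_detach_explicit[OF t45 D_perm, where \<sigma> = "(!) [\<langle>0\<rangle>, \<langle>1\<rangle> \<rightarrow> \<langle>2\<rangle>, \<langle>1\<rangle> \<rightarrow> (\<langle>0\<rangle> \<rightarrow> \<langle>0\<rangle>) \<rightarrow> \<langle>2\<rangle>]"
        and \<tau> = "(!) [\<langle>0\<rangle> \<rightarrow> \<langle>0\<rangle>, \<langle>1\<rangle>, \<langle>2\<rangle>]" and \<rho> = "\<lambda>s t. (!) [s 0, t 1, t 2]"]) auto
  have t47: "D Q (((\<langle>0\<rangle> \<rightarrow> (\<langle>1\<rangle> \<rightarrow> \<langle>1\<rangle>) \<rightarrow> \<langle>2\<rangle>) \<rightarrow> \<langle>3\<rangle>) \<rightarrow> ((\<langle>1\<rangle> \<rightarrow> \<langle>1\<rangle>) \<rightarrow> \<langle>0\<rangle> \<rightarrow> \<langle>2\<rangle>) \<rightarrow> \<langle>3\<rangle>)"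
    by (rule D_detach_explicit[OF D_A2 t46, where \<sigma> = "(!) [(\<langle>1\<rangle> \<rightarrow> \<langle>1\<rangle>) \<rightarrow> \<langle>0\<rangle> \<rightarrow> \<langle>2\<rangle>, \<langle>0\<rangle> \<rightarrow> (\<langle>1\<rangle> \<rightarrow> \<langle>1\<rangle>) \<rightarrow> \<langle>2\<rangle>, \<langle>3\<rangle>]"
        and \<tau> = "(!) [\<langle>1\<rangle>, \<langle>0\<rangle>, \<langle>2\<rangle>]" and \<rho> = "\<lambda>s t. (!) [t 1, t 0, t 2, s 2]"]) auto
  have t48: "D Q (((\<langle>0\<rangle> \<rightarrow> \<langle>0\<rangle>) \<rightarrow> (\<langle>1\<rangle> \<rightarrow> \<langle>1\<rangle>) \<rightarrow> \<langle>2\<rangle>) \<rightarrow> (\<langle>1\<rangle> \<rightarrow> \<langle>1\<rangle>) \<rightarrow> (\<langle>0\<rangle> \<rightarrow> \<langle>0\<rangle>) \<rightarrow> \<langle>2\<rangle>)"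
    by (rule D_detach_explicit[OF t47 D_tag_restrict, where \<sigma> = "(!) [\<langle>1\<rangle> \<rightarrow> \<langle>1\<rangle>, \<langle>0\<rangle>, \<langle>2\<rangle>, (\<langle>1\<rangle> \<rightarrow> \<langle>1\<rangle>) \<rightarrow> (\<langle>0\<rangle> \<rightarrow> \<langle>0\<rangle>) \<rightarrow> \<langle>2\<rangle>]"
        and \<tau> = "(!) [\<langle>1\<rangle>, (\<langle>0\<rangle> \<rightarrow> \<langle>0\<rangle>) \<rightarrow> \<langle>2\<rangle>]" and \<rho> = "\<lambda>s t. (!) [s 1, t 0, s 2]"]) auto
  have t49: "D Q (((\<langle>0\<rangle> \<rightarrow> \<langle>0\<rangle>) \<rightarrow> (\<langle>1\<rangle> \<rightarrow> \<langle>1\<rangle>) \<rightarrow> (\<langle>2\<rangle> \<rightarrow> \<langle>2\<rangle>) \<rightarrow> \<langle>3\<rangle>) \<rightarrow> (\<langle>2\<rangle> \<rightarrow> \<langle>2\<rangle>) \<rightarrow> (\<langle>1\<rangle> \<rightarrow> \<langle>1\<rangle>) \<rightarrow> \<langle>3\<rangle>)"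
    by (rule D_detach_explicit[OF D_top_ante t48, where \<sigma> = "(!) [(\<langle>1\<rangle> \<rightarrow> \<langle>1\<rangle>) \<rightarrow> (\<langle>2\<rangle> \<rightarrow> \<langle>2\<rangle>) \<rightarrow> \<langle>3\<rangle>, (\<langle>2\<rangle> \<rightarrow> \<langle>2\<rangle>) \<rightarrow> (\<langle>1\<rangle> \<rightarrow> \<langle>1\<rangle>) \<rightarrow> \<langle>3\<rangle>, \<langle>0\<rangle>]"
        and \<tau> = "(!) [\<langle>1\<rangle>, \<langle>2\<rangle>, \<langle>3\<rangle>]" and \<rho> = "\<lambda>s t. (!) [s 2, t 0, t 1, t 2]"]) auto
  have t50: "D Q ((((\<langle>0\<rangle> \<rightarrow> \<langle>0\<rangle>) \<rightarrow> (\<langle>0\<rangle> \<rightarrow> \<langle>0\<rangle>) \<rightarrow> \<langle>1\<rangle>) \<rightarrow> \<langle>2\<rangle> \<rightarrow> \<langle>2\<rangle>) \<rightarrow> \<langle>2\<rangle> \<rightarrow> \<langle>2\<rangle>)"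
    proof (rule D_detach_explicit[OF D_A3 t49, where \<sigma> = "(!) [\<langle>2\<rangle> \<rightarrow> \<langle>2\<rangle>, (\<langle>0\<rangle> \<rightarrow> \<langle>0\<rangle>) \<rightarrow> (\<langle>0\<rangle> \<rightarrow> \<langle>0\<rangle>) \<rightarrow> \<langle>1\<rangle>]"
          and \<tau> = "(!) [\<langle>2\<rangle>, \<langle>0\<rangle>, \<langle>0\<rangle>, \<langle>1\<rangle>]" and \<rho> = "\<lambda>s t. (!) [t 2, t 3, t 0]"], goal_cases)
      case (2 s t)
      \<comment> \<open>Both occurrences of one variable of A3 are matched, with the two tags in
        either order; equating the two orders forces the tag variables to coincide.\<close>
      let ?a = "\<lambda>i j. (t i \<rightarrow> t i) \<rightarrow> (t j \<rightarrow> t j) \<rightarrow> t 3"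
      have s: "s 0 = t 0 \<rightarrow> t 0 \<and> s 1 = ?a 1 2 \<and> s 1 = ?a 2 1"
        using 2 by (simp (no_asm_use))
      have "?a 1 2 = ?a 2 1" using s by (elim conjE) (erule trans[OF sym])
      then have "t 1 = t 2" unfolding form.inject by blast
      with s[THEN conjunct1] s[THEN conjunct2, THEN conjunct1] show ?case by simp
    qed auto
  have t51: "D Q (((\<langle>0\<rangle> \<rightarrow> \<langle>0\<rangle>) \<rightarrow> (\<langle>1\<rangle> \<rightarrow> \<langle>1\<rangle>) \<rightarrow> (\<langle>1\<rangle> \<rightarrow> \<langle>1\<rangle>) \<rightarrow> \<langle>2\<rangle>) \<rightarrow> (\<langle>1\<rangle> \<rightarrow> \<langle>1\<rangle>) \<rightarrow> (\<langle>1\<rangle> \<rightarrow> \<langle>1\<rangle>) \<rightarrow> \<langle>2\<rangle>)"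
    by (rule D_detach_explicit[OF D_A3 t50, where \<sigma> = "(!) [(\<langle>1\<rangle> \<rightarrow> \<langle>1\<rangle>) \<rightarrow> (\<langle>1\<rangle> \<rightarrow> \<langle>1\<rangle>) \<rightarrow> \<langle>2\<rangle>, \<langle>0\<rangle> \<rightarrow> \<langle>0\<rangle>]"
        and \<tau> = "(!) [\<langle>1\<rangle>, \<langle>2\<rangle>, \<langle>0\<rangle>]" and \<rho> = "\<lambda>s t. (!) [t 2, t 0, t 1]"]) auto
  have t52: "D Q (((\<langle>0\<rangle> \<rightarrow> \<langle>0\<rangle>) \<rightarrow> (\<langle>0\<rangle> \<rightarrow> \<langle>0\<rangle>) \<rightarrow> \<langle>1\<rangle>) \<rightarrow> (\<langle>0\<rangle> \<rightarrow> \<langle>0\<rangle>) \<rightarrow> (\<langle>0\<rangle> \<rightarrow> \<langle>0\<rangle>) \<rightarrow> \<langle>1\<rangle>)"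
    by (rule D_detach_explicit[OF D_weaken_ante t51, where \<sigma> = "(!) [\<langle>2\<rangle> \<rightarrow> \<langle>2\<rangle>, (\<langle>0\<rangle> \<rightarrow> \<langle>0\<rangle>) \<rightarrow> (\<langle>0\<rangle> \<rightarrow> \<langle>0\<rangle>) \<rightarrow> \<langle>1\<rangle>, (\<langle>0\<rangle> \<rightarrow> \<langle>0\<rangle>) \<rightarrow> (\<langle>0\<rangle> \<rightarrow> \<langle>0\<rangle>) \<rightarrow> \<langle>1\<rangle>]"
        and \<tau> = "(!) [\<langle>2\<rangle>, \<langle>0\<rangle>, \<langle>1\<rangle>]" and \<rho> = "\<lambda>s t. (!) [t 1, t 2]"]) auto
  \<comment> \<open>One of the two copies on the right is moved to the front, where identity
    detaches it.\<close>
  have t53: "D Q ((\<langle>0\<rangle> \<rightarrow> \<langle>0\<rangle>) \<rightarrow> ((\<langle>0\<rangle> \<rightarrow> \<langle>0\<rangle>) \<rightarrow> (\<langle>0\<rangle> \<rightarrow> \<langle>0\<rangle>) \<rightarrow> \<langle>1\<rangle>) \<rightarrow> (\<langle>0\<rangle> \<rightarrow> \<langle>0\<rangle>) \<rightarrow> \<langle>1\<rangle>)"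
    by (rule D_detach_explicit[OF D_perm t52, where \<sigma> = "(!) [(\<langle>0\<rangle> \<rightarrow> \<langle>0\<rangle>) \<rightarrow> (\<langle>0\<rangle> \<rightarrow> \<langle>0\<rangle>) \<rightarrow> \<langle>1\<rangle>, \<langle>0\<rangle> \<rightarrow> \<langle>0\<rangle>, (\<langle>0\<rangle> \<rightarrow> \<langle>0\<rangle>) \<rightarrow> \<langle>1\<rangle>]"
        and \<tau> = "(!) [\<langle>0\<rangle>, \<langle>1\<rangle>]" and \<rho> = "\<lambda>s t. (!) [t 0, t 1]"]) auto
  show ?thesis
    by (rule D_detach_explicit[OF t53 D_id, where \<sigma> = "(!) [\<langle>0\<rangle>, \<langle>1\<rangle>]"
        and \<tau> = "(!) [\<langle>0\<rangle>]" and \<rho> = "\<lambda>s t. (!) [t 0, s 1]"]) auto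
qed

text \<open>Prefixing and permutation give the version with two unrelated premisses
  (\<open>t59\<close>); unification with the lifted contraction law (\<open>t61\<close>) makes both
  the same tag and merges them.\<close>

lemma D_tag_combine: "D Q ((\<langle>0\<rangle> \<rightarrow> \<langle>1\<rangle> \<rightarrow> \<langle>2\<rangle>) \<rightarrow> ((\<langle>3\<rangle> \<rightarrow> \<langle>3\<rangle>) \<rightarrow> \<langle>0\<rangle>) \<rightarrow> ((\<langle>3\<rangle> \<rightarrow> \<langle>3\<rangle>) \<rightarrow> \<langle>1\<rangle>) \<rightarrow> (\<langle>3\<rangle> \<rightarrow> \<langle>3\<rangle>) \<rightarrow> \<langle>2\<rangle>)"
proof -
  have t55: "D Q ((\<langle>0\<rangle> \<rightarrow> \<langle>1\<rangle> \<rightarrow> \<langle>2\<rangle> \<rightarrow> \<langle>3\<rangle>) \<rightarrow> \<langle>0\<rangle> \<rightarrow> \<langle>2\<rangle> \<rightarrow> \<langle>1\<rangle> \<rightarrow> \<langle>3\<rangle>)"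
    by (rule D_detach_explicit[OF D_prefix D_perm, where \<sigma> = "(!) [\<langle>1\<rangle> \<rightarrow> \<langle>2\<rangle> \<rightarrow> \<langle>3\<rangle>, \<langle>2\<rangle> \<rightarrow> \<langle>1\<rangle> \<rightarrow> \<langle>3\<rangle>, \<langle>0\<rangle>]"
        and \<tau> = "(!) [\<langle>1\<rangle>, \<langle>2\<rangle>, \<langle>3\<rangle>]" and \<rho> = "\<lambda>s t. (!) [s 2, t 0, t 1, t 2]"]) auto
  have t56: "D Q ((\<langle>0\<rangle> \<rightarrow> \<langle>1\<rangle> \<rightarrow> \<langle>2\<rangle>) \<rightarrow> (\<langle>3\<rangle> \<rightarrow> \<langle>0\<rangle>) \<rightarrow> \<langle>1\<rangle> \<rightarrow> \<langle>3\<rangle> \<rightarrow> \<langle>2\<rangle>)"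
    by (rule D_detach_explicit[OF D_prefix_ante t55, where \<sigma> = "(!) [\<langle>3\<rangle>, \<langle>0\<rangle>, \<langle>1\<rangle> \<rightarrow> \<langle>2\<rangle>, (\<langle>3\<rangle> \<rightarrow> \<langle>0\<rangle>) \<rightarrow> \<langle>1\<rangle> \<rightarrow> \<langle>3\<rangle> \<rightarrow> \<langle>2\<rangle>]"
        and \<tau> = "(!) [\<langle>3\<rangle> \<rightarrow> \<langle>0\<rangle>, \<langle>3\<rangle>, \<langle>1\<rangle>, \<langle>2\<rangle>]" and \<rho> = "\<lambda>s t. (!) [s 1, t 2, t 3, t 1]"]) auto
  have t58: "D Q ((((\<langle>0\<rangle> \<rightarrow> \<langle>1\<rangle>) \<rightarrow> \<langle>2\<rangle> \<rightarrow> \<langle>0\<rangle> \<rightarrow> \<langle>3\<rangle>) \<rightarrow> \<langle>4\<rangle>) \<rightarrow> (\<langle>1\<rangle> \<rightarrow> \<langle>2\<rangle> \<rightarrow> \<langle>3\<rangle>) \<rightarrow> \<langle>4\<rangle>)"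
    by (rule D_detach_explicit[OF D_A2 t56, where \<sigma> = "(!) [\<langle>1\<rangle> \<rightarrow> \<langle>2\<rangle> \<rightarrow> \<langle>3\<rangle>, (\<langle>0\<rangle> \<rightarrow> \<langle>1\<rangle>) \<rightarrow> \<langle>2\<rangle> \<rightarrow> \<langle>0\<rangle> \<rightarrow> \<langle>3\<rangle>, \<langle>4\<rangle>]"
        and \<tau> = "(!) [\<langle>1\<rangle>, \<langle>2\<rangle>, \<langle>3\<rangle>, \<langle>0\<rangle>]" and \<rho> = "\<lambda>s t. (!) [t 3, t 0, t 1, t 2, s 2]"]) auto
  have t57: "D Q ((\<langle>0\<rangle> \<rightarrow> \<langle>1\<rangle> \<rightarrow> \<langle>2\<rangle>) \<rightarrow> \<langle>0\<rangle> \<rightarrow> (\<langle>3\<rangle> \<rightarrow> \<langle>1\<rangle>) \<rightarrow> \<langle>3\<rangle> \<rightarrow> \<langle>2\<rangle>)"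
    by (rule D_detach_explicit[OF D_prefix D_prefix, where \<sigma> = "(!) [\<langle>1\<rangle> \<rightarrow> \<langle>2\<rangle>, (\<langle>3\<rangle> \<rightarrow> \<langle>1\<rangle>) \<rightarrow> \<langle>3\<rangle> \<rightarrow> \<langle>2\<rangle>, \<langle>0\<rangle>]"
        and \<tau> = "(!) [\<langle>1\<rangle>, \<langle>2\<rangle>, \<langle>3\<rangle>]" and \<rho> = "\<lambda>s t. (!) [s 2, t 0, t 1, t 2]"]) auto
  have t59: "D Q ((\<langle>0\<rangle> \<rightarrow> \<langle>1\<rangle> \<rightarrow> \<langle>2\<rangle>) \<rightarrow> (\<langle>3\<rangle> \<rightarrow> \<langle>0\<rangle>) \<rightarrow> (\<langle>4\<rangle> \<rightarrow> \<langle>1\<rangle>) \<rightarrow> \<langle>4\<rangle> \<rightarrow> \<langle>3\<rangle> \<rightarrow> \<langle>2\<rangle>)"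
    by (rule D_detach_explicit[OF t58 t57, where \<sigma> = "(!) [\<langle>3\<rangle>, \<langle>0\<rangle>, \<langle>1\<rangle>, \<langle>2\<rangle>, (\<langle>3\<rangle> \<rightarrow> \<langle>0\<rangle>) \<rightarrow> (\<langle>4\<rangle> \<rightarrow> \<langle>1\<rangle>) \<rightarrow> \<langle>4\<rangle> \<rightarrow> \<langle>3\<rangle> \<rightarrow> \<langle>2\<rangle>]"
        and \<tau> = "(!) [\<langle>3\<rangle> \<rightarrow> \<langle>0\<rangle>, \<langle>1\<rangle>, \<langle>3\<rangle> \<rightarrow> \<langle>2\<rangle>, \<langle>4\<rangle>]" and \<rho> = "\<lambda>s t. (!) [s 1, t 1, s 3, s 0, t 3]"]) auto
  have t62: "D Q ((((\<langle>0\<rangle> \<rightarrow> \<langle>1\<rangle>) \<rightarrow> (\<langle>2\<rangle> \<rightarrow> \<langle>3\<rangle>) \<rightarrow> \<langle>2\<rangle> \<rightarrow> \<langle>0\<rangle> \<rightarrow> \<langle>4\<rangle>) \<rightarrow> \<langle>5\<rangle>) \<rightarrow> (\<langle>1\<rangle> \<rightarrow> \<langle>3\<rangle> \<rightarrow> \<langle>4\<rangle>) \<rightarrow> \<langle>5\<rangle>)"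
    by (rule D_detach_explicit[OF D_A2 t59, where \<sigma> = "(!) [\<langle>1\<rangle> \<rightarrow> \<langle>3\<rangle> \<rightarrow> \<langle>4\<rangle>, (\<langle>0\<rangle> \<rightarrow> \<langle>1\<rangle>) \<rightarrow> (\<langle>2\<rangle> \<rightarrow> \<langle>3\<rangle>) \<rightarrow> \<langle>2\<rangle> \<rightarrow> \<langle>0\<rangle> \<rightarrow> \<langle>4\<rangle>, \<langle>5\<rangle>]"
        and \<tau> = "(!) [\<langle>1\<rangle>, \<langle>3\<rangle>, \<langle>4\<rangle>, \<langle>0\<rangle>, \<langle>2\<rangle>]" and \<rho> = "\<lambda>s t. (!) [t 3, t 0, t 4, t 1, t 2, s 2]"]) auto
  have t60: "D Q ((\<langle>0\<rangle> \<rightarrow> (\<langle>1\<rangle> \<rightarrow> \<langle>1\<rangle>) \<rightarrow> (\<langle>1\<rangle> \<rightarrow> \<langle>1\<rangle>) \<rightarrow> \<langle>2\<rangle>) \<rightarrow> \<langle>0\<rangle> \<rightarrow> (\<langle>1\<rangle> \<rightarrow> \<langle>1\<rangle>) \<rightarrow> \<langle>2\<rangle>)"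
    by (rule D_detach_explicit[OF D_prefix D_tag_contract, where \<sigma> = "(!) [(\<langle>1\<rangle> \<rightarrow> \<langle>1\<rangle>) \<rightarrow> (\<langle>1\<rangle> \<rightarrow> \<langle>1\<rangle>) \<rightarrow> \<langle>2\<rangle>, (\<langle>1\<rangle> \<rightarrow> \<langle>1\<rangle>) \<rightarrow> \<langle>2\<rangle>, \<langle>0\<rangle>]"
        and \<tau> = "(!) [\<langle>1\<rangle>, \<langle>2\<rangle>]" and \<rho> = "\<lambda>s t. (!) [s 2, t 0, t 1]"]) auto
  have t61: "D Q ((\<langle>0\<rangle> \<rightarrow> \<langle>1\<rangle> \<rightarrow> (\<langle>2\<rangle> \<rightarrow> \<langle>2\<rangle>) \<rightarrow> (\<langle>2\<rangle> \<rightarrow> \<langle>2\<rangle>) \<rightarrow> \<langle>3\<rangle>) \<rightarrow> \<langle>0\<rangle> \<rightarrow> \<langle>1\<rangle> \<rightarrow> (\<langle>2\<rangle> \<rightarrow> \<langle>2\<rangle>) \<rightarrow> \<langle>3\<rangle>)"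
    by (rule D_detach_explicit[OF D_prefix t60, where \<sigma> = "(!) [\<langle>1\<rangle> \<rightarrow> (\<langle>2\<rangle> \<rightarrow> \<langle>2\<rangle>) \<rightarrow> (\<langle>2\<rangle> \<rightarrow> \<langle>2\<rangle>) \<rightarrow> \<langle>3\<rangle>, \<langle>1\<rangle> \<rightarrow> (\<langle>2\<rangle> \<rightarrow> \<langle>2\<rangle>) \<rightarrow> \<langle>3\<rangle>, \<langle>0\<rangle>]"
        and \<tau> = "(!) [\<langle>1\<rangle>, \<langle>2\<rangle>, \<langle>3\<rangle>]" and \<rho> = "\<lambda>s t. (!) [s 2, t 0, t 1, t 2]"]) auto
  show ?thesis
    by (rule D_detach_explicit[OF t62 t61, where \<sigma> = "(!) [\<langle>3\<rangle> \<rightarrow> \<langle>3\<rangle>, \<langle>0\<rangle>, \<langle>3\<rangle> \<rightarrow> \<langle>3\<rangle>, \<langle>1\<rangle>, \<langle>2\<rangle>, ((\<langle>3\<rangle> \<rightarrow> \<langle>3\<rangle>) \<rightarrow> \<langle>0\<rangle>) \<rightarrow> ((\<langle>3\<rangle> \<rightarrow> \<langle>3\<rangle>) \<rightarrow> \<langle>1\<rangle>) \<rightarrow> (\<langle>3\<rangle> \<rightarrow> \<langle>3\<rangle>) \<rightarrow> \<langle>2\<rangle>]"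
        and \<tau> = "(!) [(\<langle>3\<rangle> \<rightarrow> \<langle>3\<rangle>) \<rightarrow> \<langle>0\<rangle>, (\<langle>3\<rangle> \<rightarrow> \<langle>3\<rangle>) \<rightarrow> \<langle>1\<rangle>, \<langle>3\<rangle>, \<langle>2\<rangle>]" and \<rho> = "\<lambda>s t. (!) [s 1, s 3, t 3, t 2]"]) auto
qed
section \<open>Elimination of all double negations\<close>

text \<open>Negations cancel in pairs from the inside out, so each maximal chain of negations is cut
  down to its parity.\<close>

primrec red :: "form \<Rightarrow> form" where
  "red \<langle>v\<rangle> = \<langle>v\<rangle>"
| "red (a \<rightarrow> b) = red a \<rightarrow> red b"
| "red (\<sim>a) = (case red a of \<sim>b \<Rightarrow> b | _ \<Rightarrow> \<sim>(red a))"

lemma dn_free_red: "dn_free (red F)"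
  by (induction F) (auto split: form.splits)

lemma red_Neg_Neg [simp]: "red (\<sim>\<sim>a) = red a"
  using dn_free_red[of a] by (auto split: form.splits)

lemma red_dn_repl: "red (dn_repl S F) = red F"
proof (induction S F rule: dn_repl.induct)
  case (3 S a)
  show ?case
  proof (cases "\<sim>a \<in> S")
    case True
    then show ?thesis using 3 by (cases a) (auto simp del: red.simps(3) simp: red.simps(3)[of "\<langle>_\<rangle>"] red.simps(3)[of "_ \<rightarrow> _"])
  next
    case False
    then show ?thesis using 3 by (auto split: form.split)
  qed
qed auto

primrec val :: "(nat \<Rightarrow> bool) \<Rightarrow> form \<Rightarrow> bool" where
  "val e \<langle>v\<rangle> = e v"
| "val e (a \<rightarrow> b) = (val e a \<longrightarrow> val e b)"
| "val e (\<sim>a) = (\<not> val e a)"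

lemma val_subst: "val e (subst s F) = val (\<lambda>v. val e (s v)) F"
  by (induction F) auto

text \<open>Classical two-valued soundness; it serves to show that a derived major premiss is not a
  bare variable.\<close>

lemma D_val: "D Q F \<Longrightarrow> val e F"
proof (induction arbitrary: e rule: der.induct)
  case (ax F)
  then obtain a r where "a \<in> {A1, A2, A3, A4}" "subst (Var \<circ> r) a = F"
    unfolding is_axiom_def variant_def by blast
  then show ?case by (auto simp: A1_def A2_def A3_def A4_def x_def y_def z_def)
next
  case (cd M m R)
  from cd.hyps(3) obtain a b c s r1 r2 r3 where *:
    "subst (Var \<circ> r1) M = a \<rightarrow> b" "subst (Var \<circ> r2) m = c" "subst s a = subst s c"
    "subst (Var \<circ> r3) (subst s b) = R"
    unfolding cd_def variant_def is_mgu_def by blast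
  have "val e (subst (Var \<circ> r3) (subst s (a \<rightarrow> b)))"
    unfolding *(1)[symmetric] val_subst by (rule cd.IH(1))
  moreover have "val e (subst (Var \<circ> r3) (subst s a))"
    unfolding *(3) *(2)[symmetric] val_subst by (rule cd.IH(2))
  ultimately show ?case using *(4) by simp
qed

text \<open>Modus ponens on instances lifts to condensed detachment on the derived formulas: the
  most general conclusion has \<open>b\<close> as an instance and so inherits the absence of double
  negations.\<close>

lemma D_instance_detach:
  assumes "D Q F" "D Q G" "subst \<sigma> F = a \<rightarrow> b" "subst \<tau> G = a" "dn_free b"
  shows "\<exists>R \<rho>. D Q R \<and> subst \<rho> R = b"
proof -
  have "F \<noteq> \<langle>v\<rangle>" for v using D_val[OF assms(1), of "\<lambda>_. False"] by auto
  then obtain a' b' where F: "F = a' \<rightarrow> b'" using assms(3) by (cases F) auto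
  have eq: "subst \<sigma> a' = subst \<tau> G" "subst \<sigma> b' = b" using assms(3,4) F by auto
  obtain s t \<rho> where R: "cd (a' \<rightarrow> b') G (subst s b')" "subst \<rho> (subst s b') = b"
    using cd_exists[OF eq(1), of b'] eq(2) by blast
  then have "dn_free (subst s b')" using assms(5) dn_free_if_instance by metis
  then have "D Q (subst s b')"
    using der.cd[OF assms(1)[unfolded F] assms(2) R(1)] dn_in_if_free by blast
  then show ?thesis using R(2) by blast
qed

text \<open>A1 to A3 contain no negation, so reduction passes through them. In A4 a displayed
  negation may cancel against one heading the reduced formula below it; the four cases give A4 and
  the three contraposition laws.\<close>

lemma D_red_axiom:
  assumes "a \<in> {A1, A2, A3, A4}"
  shows "\<exists>C \<tau>. D Q C \<and> subst \<tau> C = red (subst \<sigma> a)"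
proof -
  have inst: ?thesis if "D Q C" "subst \<tau> C = red (subst \<sigma> a)" for C \<tau>
    using that by blast
  consider "a = A1" | "a = A2" | "a = A3" | "a = A4" using assms by blast
  then show ?thesis
  proof cases
    case 1
    then show ?thesis
      by (intro inst[OF D_A1, of "\<lambda>v. red (\<sigma> v)"]) (simp add: A1_def x_def y_def)
  next
    case 2
    then show ?thesis
      by (intro inst[OF D_A2, of "\<lambda>v. red (\<sigma> v)"]) (simp add: A2_def x_def y_def z_def)
  next
    case 3
    then show ?thesis
      by (intro inst[OF D_A3, of "\<lambda>v. red (\<sigma> v)"]) (simp add: A3_def x_def y_def)
  next
    case 4
    let ?p = "red (\<sigma> 0)" and ?q = "red (\<sigma> 1)"
    note [simp] = A4_def x_def y_def
    show ?thesis
    proof (cases "\<exists>b. ?p = \<sim>b")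
      case True
      then obtain b where p: "?p = \<sim>b" ..
      show ?thesis
      proof (cases "\<exists>c. ?q = \<sim>c")
        case True
        then obtain c where "?q = \<sim>c" ..
        with 4 p show ?thesis by (intro inst[OF D_contrapos, of "(!) [b, c]"]) simp
      next
        case False
        with 4 p show ?thesis
          by (intro inst[OF D_contrapos_right, of "(!) [b, ?q]"]) (simp split: form.split)
      qed
    next
      case False
      then have p: "red (\<sim>\<sigma> 0) = \<sim>?p" by (simp split: form.split)
      show ?thesis
      proof (cases "\<exists>c. ?q = \<sim>c")
        case True
        then obtain c where "?q = \<sim>c" ..
        with 4 p show ?thesis
          by (intro inst[OF D_contrapos_left, of "(!) [?p, c]"]) (simp del: red.simps(3) add: red.simps(3)[of "\<sigma> (Suc 0)"])
      next
        case False
        then have "red (\<sim>\<sigma> 1) = \<sim>?q" by (simp split: form.split)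
        with 4 p show ?thesis
          by (intro inst[OF D_A4, of "(!) [?p, ?q]"]) (simp del: red.simps(3))
      qed
    qed
  qed
qed

text \<open>All instances are treated at once, since reduction does not commute with substitution
  and an inference step instantiates its premisses.\<close>

lemma D_red_instance:
  assumes "der {A1, A2, A3, A4} (\<lambda>_. True) F"
  shows "\<exists>C \<tau>. D Q C \<and> subst \<tau> C = red (subst \<sigma> F)"
  using assms
proof (induction arbitrary: \<sigma> rule: der.induct)
  case (ax F)
  then obtain a where a: "a \<in> {A1, A2, A3, A4}" "variant a F" unfolding is_axiom_def by blast
  obtain t where "subst \<sigma> F = subst t a" using variant_subst[OF a(2)] by blast
  with D_red_axiom[OF a(1)] show ?case by metis
next
  case (cd M m R)
  from cd.hyps(3) obtain a b c s where *: "variant M (a \<rightarrow> b)" "variant m c"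
    "subst s a = subst s c" "variant (subst s b) R"
    unfolding cd_def is_mgu_def by blast
  obtain t where t: "subst \<sigma> R = subst t (subst s b)" using variant_subst[OF *(4)] by blast
  define \<theta> where "\<theta> = (\<lambda>v. subst t (s v))"
  have \<theta>: "subst \<theta> F = subst t (subst s F)" for F by (simp add: \<theta>_def subst_subst)
  obtain \<theta>1 where "subst \<theta> (a \<rightarrow> b) = subst \<theta>1 M" using variant_subst[OF *(1)] by blast
  then obtain F \<tau>1 where F: "D Q F" "subst \<tau>1 F = red (subst \<theta> a) \<rightarrow> red (subst \<theta> b)"
    using cd.IH(1)[of \<theta>1] by (metis red.simps(2) subst.simps(2))
  obtain \<theta>2 where "subst \<theta> c = subst \<theta>2 m" using variant_subst[OF *(2)] by blast
  then obtain G \<tau>2 where G: "D Q G" "subst \<tau>2 G = red (subst \<theta> a)"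
    using cd.IH(2)[of \<theta>2] \<theta> *(3) by metis
  show ?case
    using D_instance_detach[OF F(1) G(1) F(2) G(2) dn_free_red] t \<theta> by simp
qed

section \<open>Restoring double negations\<close>

text \<open>A derivation of \<open>red F \<rightarrow> F\<close> has to build \<open>F\<close> from its subformulas without ever renaming apart
  variables below a double negation. The premises \<open>\<langle>v\<rangle> \<rightarrow> \<langle>v\<rangle>\<close> collected by \<open>ctx\<close> expose the variables,
  so that combining two theorems identifies the variables they share.\<close>

primrec ctx :: "nat \<Rightarrow> form \<Rightarrow> form" where
  "ctx 0 F = F"
| "ctx (Suc n) F = (\<langle>n\<rangle> \<rightarrow> \<langle>n\<rangle>) \<rightarrow> ctx n F"

lemma vars_ctx [simp]: "vars (ctx n F) = {..<n} \<union> vars F"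
  by (induction n) (simp_all add: lessThan_Suc insert_commute)

lemma subst_ctx: "(\<And>v. v < n \<Longrightarrow> \<sigma> v = \<langle>v\<rangle>) \<Longrightarrow> subst \<sigma> (ctx n F) = ctx n (subst \<sigma> F)"
  by (induction n) auto

lemma dn_in_ctx [simp]: "dn_in Q (ctx n F) \<longleftrightarrow> dn_in Q F"
  by (induction n) auto

text \<open>Tag \<open>k\<close> must share its variable with the conclusion and therefore comes
  from \<open>D_tag_refl\<close>. Tags with smaller index are inserted beneath it, those with larger
  index added in front.\<close>

lemma D_ctx_id:
  assumes "k < n" shows "D Q (ctx n (\<langle>k\<rangle> \<rightarrow> \<langle>k\<rangle>))"
proof -
  have k: "D Q ((\<langle>k\<rangle> \<rightarrow> \<langle>k\<rangle>) \<rightarrow> ctx m (\<langle>k\<rangle> \<rightarrow> \<langle>k\<rangle>))" if "m \<le> k" for m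
    using that
  proof (induction m)
    case 0
    show ?case
      by (rule D_variant[OF D_tag_refl], rule variant_if_instances[of "\<lambda>_. \<langle>k\<rangle>" _ _ "\<lambda>_. \<langle>0\<rangle>"]) auto
  next
    case (Suc m)
    let ?\<sigma> = "(!) [\<langle>k\<rangle> \<rightarrow> \<langle>k\<rangle>, ctx m (\<langle>k\<rangle> \<rightarrow> \<langle>k\<rangle>), \<langle>m\<rangle>]"
    have "D Q (subst ?\<sigma> (\<langle>0\<rangle> \<rightarrow> (\<langle>2\<rangle> \<rightarrow> \<langle>2\<rangle>) \<rightarrow> \<langle>1\<rangle>))"
      by (rule D_detach_major[OF D_tag_weaken_inner]) (use Suc in \<open>auto simp: inj_on_def\<close>)
    then show ?case by simp
  qed
  from assms show ?thesis
  proof (induction n)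
    case (Suc n)
    show ?case
    proof (cases "k = n")
      case True
      then show ?thesis using k[of k] by simp
    next
      case False
      let ?\<sigma> = "(!) [ctx n (\<langle>k\<rangle> \<rightarrow> \<langle>k\<rangle>), \<langle>n\<rangle>]"
      have "D Q (subst ?\<sigma> ((\<langle>1\<rangle> \<rightarrow> \<langle>1\<rangle>) \<rightarrow> \<langle>0\<rangle>))"
        by (rule D_detach_major[OF D_tag_weaken]) (use Suc False in \<open>auto simp: inj_on_def\<close>)
      then show ?thesis by simp
    qed
  qed simp
qed

text \<open>Variables of \<open>F\<close> and \<open>G\<close> stay at or above \<open>l\<close>, so
  each new tag variable is fresh; the link between tags and formulas is made only later, by
  instantiation.\<close>

lemma D_ctx_lift:
  assumes "D Q (F \<rightarrow> G)" "vars F \<union> vars G \<subseteq> {l..}" "dn_in Q F" "dn_in Q G" "n \<le> l"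
  shows "D Q (ctx n F \<rightarrow> ctx n G)"
  using assms(5)
proof (induction n)
  case (Suc n)
  let ?\<sigma> = "(!) [ctx n F, ctx n G, \<langle>n\<rangle>]"
  have "n \<notin> vars F" "n \<notin> vars G" using assms(2) Suc.prems by auto
  then have "D Q (subst ?\<sigma> (((\<langle>2\<rangle> \<rightarrow> \<langle>2\<rangle>) \<rightarrow> \<langle>0\<rangle>) \<rightarrow> (\<langle>2\<rangle> \<rightarrow> \<langle>2\<rangle>) \<rightarrow> \<langle>1\<rangle>))"
    by (intro D_detach_major[OF D_tag_prefix]) (use Suc assms(3,4) in \<open>auto simp: inj_on_def\<close>)
  then show ?case by simp
qed (use assms in simp)

lemma D_ctx_lift2:
  assumes "D Q (F \<rightarrow> G \<rightarrow> H)" "vars F \<union> vars G \<union> vars H \<subseteq> {l..}"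
    "dn_in Q F" "dn_in Q G" "dn_in Q H" "n \<le> l"
  shows "D Q (ctx n F \<rightarrow> ctx n G \<rightarrow> ctx n H)"
  using assms(6)
proof (induction n)
  case (Suc n)
  let ?\<sigma> = "(!) [ctx n F, ctx n G, ctx n H, \<langle>n\<rangle>]"
  have "n \<notin> vars F" "n \<notin> vars G" "n \<notin> vars H" using assms(2) Suc.prems by auto
  then have "D Q (subst ?\<sigma> (((\<langle>3\<rangle> \<rightarrow> \<langle>3\<rangle>) \<rightarrow> \<langle>0\<rangle>) \<rightarrow> ((\<langle>3\<rangle> \<rightarrow> \<langle>3\<rangle>) \<rightarrow> \<langle>1\<rangle>) \<rightarrow> (\<langle>3\<rangle> \<rightarrow> \<langle>3\<rangle>) \<rightarrow> \<langle>2\<rangle>))"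
    by (intro D_detach_major[OF D_tag_combine]) (use Suc assms(3-5) in \<open>auto simp: inj_on_def\<close>)
  then show ?case by simp
qed (use assms in simp)

lemma D_ctx_detach:
  assumes "D Q (F \<rightarrow> G)" "dn_free F" "dn_free G" "vars G \<subseteq> vars F"
    and "D Q (ctx n (subst \<sigma> F))" "dn_in Q (subst \<sigma> G)"
  shows "D Q (ctx n (subst \<sigma> G))"
proof -
  let ?s = "\<lambda>v. \<langle>v + n\<rangle>"
  have var: "variant H (subst ?s H)" for H
    by (rule variant_if_instances[of ?s _ _ "\<lambda>v. \<langle>v - n\<rangle>"]) (simp_all add: subst_subst)
  have "D Q (subst ?s F \<rightarrow> subst ?s G)"
    using D_variant[OF assms(1) var] by simp
  then have major: "D Q (ctx n (subst ?s F) \<rightarrow> ctx n (subst ?s G))"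
    using dn_in_variant[OF dn_in_if_free var] assms(2,3)
    by (intro D_ctx_lift[where l = n]) (auto simp: vars_subst)
  \<comment> \<open>The tags of the lifted major premiss match those of the minor one by one, while
    \<open>\<sigma>\<close> acts on the copy shifted by \<open>n\<close>.\<close>
  define \<theta> where "\<theta> v = (if v < n then \<langle>v\<rangle> else \<sigma> (v - n))" for v
  have \<theta>: "subst \<theta> (ctx n (subst ?s H)) = ctx n (subst \<sigma> H)" for H
    by (subst subst_ctx) (simp_all add: \<theta>_def subst_subst)
  show ?thesis
    unfolding \<theta>[symmetric] by (rule D_detach_major_subset[OF major]) (use assms in \<open>auto simp: \<theta> vars_subst\<close>)
qed

text \<open>Two detachments from the lifted \<open>D_imp_mono\<close>. After the first,
  \<open>r\<close> and \<open>t\<close> are still the variables \<open>n + 2\<close> and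
  \<open>n + 3\<close>; at the second, the common tags identify the variables of \<open>p\<close>
  and \<open>q\<close> with those of \<open>r\<close> and \<open>t\<close>.\<close>

lemma D_ctx_imp:
  assumes "D Q (ctx n (p \<rightarrow> q))" "D Q (ctx n (r \<rightarrow> t))"
    and vars: "vars p \<subseteq> {..<n}" "vars q \<subseteq> {..<n}" "vars r \<subseteq> {..<n}" "vars t \<subseteq> {..<n}"
    and dn: "dn_in Q p" "dn_in Q q" "dn_in Q r" "dn_in Q t"
  shows "D Q (ctx n ((q \<rightarrow> r) \<rightarrow> p \<rightarrow> t))"
proof -
  let ?v = "\<lambda>i. \<langle>n + i\<rangle>"
  have "D Q ((?v 0 \<rightarrow> ?v 1) \<rightarrow> (?v 2 \<rightarrow> ?v 3) \<rightarrow> (?v 1 \<rightarrow> ?v 2) \<rightarrow> ?v 0 \<rightarrow> ?v 3)"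
    by (rule D_variant[OF D_imp_mono], rule variant_if_instances[of ?v _ _ "\<lambda>v. \<langle>v - n\<rangle>"]) auto
  then have major: "D Q (ctx n (?v 0 \<rightarrow> ?v 1) \<rightarrow> ctx n (?v 2 \<rightarrow> ?v 3) \<rightarrow> ctx n ((?v 1 \<rightarrow> ?v 2) \<rightarrow> ?v 0 \<rightarrow> ?v 3))"
    by (rule D_ctx_lift2[where l = n]) auto
  define \<theta> where "\<theta> = Var(n := p, n + 1 := q)"
  have \<theta>: "subst \<theta> (ctx n H) = ctx n (subst \<theta> H)" for H
    by (rule subst_ctx) (simp add: \<theta>_def)
  have "D Q (subst \<theta> (ctx n (?v 2 \<rightarrow> ?v 3) \<rightarrow> ctx n ((?v 1 \<rightarrow> ?v 2) \<rightarrow> ?v 0 \<rightarrow> ?v 3)))"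
  proof (rule D_detach_major[OF major])
    show "D Q (subst \<theta> (ctx n (?v 0 \<rightarrow> ?v 1)))" using assms(1) unfolding \<theta> by (simp add: \<theta>_def)
    have diff: "vars (ctx n (?v 2 \<rightarrow> ?v 3) \<rightarrow> ctx n ((?v 1 \<rightarrow> ?v 2) \<rightarrow> ?v 0 \<rightarrow> ?v 3))
      - vars (ctx n (?v 0 \<rightarrow> ?v 1)) = {n + 2, n + 3}" by auto
    show "inj_on \<theta> (vars (ctx n (?v 2 \<rightarrow> ?v 3) \<rightarrow> ctx n ((?v 1 \<rightarrow> ?v 2) \<rightarrow> ?v 0 \<rightarrow> ?v 3))
      - vars (ctx n (?v 0 \<rightarrow> ?v 1)))" unfolding diff by (simp add: \<theta>_def)
    show "\<exists>w. \<theta> v = \<langle>w\<rangle> \<and> w \<notin> vars (subst \<theta> (ctx n (?v 0 \<rightarrow> ?v 1)))"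
      if "v \<in> vars (ctx n (?v 2 \<rightarrow> ?v 3) \<rightarrow> ctx n ((?v 1 \<rightarrow> ?v 2) \<rightarrow> ?v 0 \<rightarrow> ?v 3))
        - vars (ctx n (?v 0 \<rightarrow> ?v 1))" for v
      using that vars(1,2) unfolding diff \<theta> by (auto simp: \<theta>_def)
    show "dn_in Q (subst \<theta> (ctx n (?v 2 \<rightarrow> ?v 3) \<rightarrow> ctx n ((?v 1 \<rightarrow> ?v 2) \<rightarrow> ?v 0 \<rightarrow> ?v 3)))"
      using dn by (simp add: \<theta>) (simp add: \<theta>_def)
  qed
  then have major2: "D Q (ctx n (?v 2 \<rightarrow> ?v 3) \<rightarrow> ctx n ((q \<rightarrow> ?v 2) \<rightarrow> p \<rightarrow> ?v 3))"
    by (simp add: \<theta>) (simp add: \<theta>_def)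
  define \<eta> where "\<eta> = Var(n + 2 := r, n + 3 := t)"
  have \<eta>: "subst \<eta> (ctx n H) = ctx n (subst \<eta> H)" for H
    by (rule subst_ctx) (simp add: \<eta>_def)
  have id: "subst \<eta> p = p" "subst \<eta> q = q"
    using vars(1,2) by (auto intro!: subst_ident simp: \<eta>_def)
  have "D Q (subst \<eta> (ctx n ((q \<rightarrow> ?v 2) \<rightarrow> p \<rightarrow> ?v 3)))"
  proof (rule D_detach_major_subset[OF major2])
    show "D Q (subst \<eta> (ctx n (?v 2 \<rightarrow> ?v 3)))" using assms(2) unfolding \<eta> by (simp add: \<eta>_def)
    show "vars (ctx n ((q \<rightarrow> ?v 2) \<rightarrow> p \<rightarrow> ?v 3)) \<subseteq> vars (ctx n (?v 2 \<rightarrow> ?v 3))"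
      using vars(1,2) by auto
    show "dn_in Q (subst \<eta> (ctx n ((q \<rightarrow> ?v 2) \<rightarrow> p \<rightarrow> ?v 3)))"
      using dn by (simp add: \<eta> id) (simp add: \<eta>_def)
  qed
  then show ?thesis by (simp add: \<eta> id) (simp add: \<eta>_def)
qed

lemma vars_red: "vars (red F) \<subseteq> vars F"
  by (induction F) (auto split: form.splits)

text \<open>Both directions are carried along because negation and the antecedent of an implication
  reverse them.\<close>

lemma D_ctx_red:
  assumes "vars F \<subseteq> {..<n}" "dn_in Q F"
  shows "D Q (ctx n (F \<rightarrow> red F)) \<and> D Q (ctx n (red F \<rightarrow> F))"
  using assms
proof (induction F)
  case (Var v)
  then show ?case using D_ctx_id by simp
next
  case (I a b)
  have "vars (red a) \<subseteq> {..<n}" "vars (red b) \<subseteq> {..<n}"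
    using vars_red[of a] vars_red[of b] I.prems(1) by auto
  then show ?case
    using I D_ctx_imp[of Q n "red a" a b "red b"] D_ctx_imp[of Q n a "red a" "red b" b]
      dn_in_if_free[OF dn_free_red] by simp
next
  case (N a)
  then have a: "D Q (ctx n (a \<rightarrow> red a))" "D Q (ctx n (red a \<rightarrow> a))"
    using dn_in_NegD by auto
  have detach: "D Q (ctx n (subst ((!) [p, q]) G))"
    if "D Q (F \<rightarrow> G)" "D Q (ctx n (subst ((!) [p, q]) F))"
      "dn_free F" "dn_free G" "vars G \<subseteq> vars F" "dn_in Q (subst ((!) [p, q]) G)" for F G p q
    using D_ctx_detach that by blast
  have dn: "dn_in Q (red H)" for H using dn_in_if_free[OF dn_free_red] .
  show ?case
  \<comment> \<open>If \<open>red a = \<sim>c\<close>, then \<open>\<sim>a\<close> reduces to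
    \<open>c\<close>, and plain contraposition would have to create \<open>\<sim>\<sim>c\<close>;
    the two mixed laws reach \<open>c\<close> directly.\<close>
  proof (cases "\<exists>c. red a = \<sim>c")
    case True
    then obtain c where c: "red a = \<sim>c" ..
    have "D Q (ctx n (subst ((!) [c, a]) (\<sim>\<langle>1\<rangle> \<rightarrow> \<langle>0\<rangle>)))"
      by (rule detach[OF D_contrapos_left]) (use a c N.prems dn[of "\<sim>a"] in auto)
    moreover have "D Q (ctx n (subst ((!) [a, c]) (\<langle>1\<rangle> \<rightarrow> \<sim>\<langle>0\<rangle>)))"
      by (rule detach[OF D_contrapos_right]) (use a c N.prems dn[of "\<sim>a"] in auto)
    ultimately show ?thesis using c by simp
  next
    case False
    then have red: "red (\<sim>a) = \<sim>(red a)" by (simp split: form.split)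
    have "D Q (ctx n (subst ((!) [red a, a]) (\<sim>\<langle>1\<rangle> \<rightarrow> \<sim>\<langle>0\<rangle>)))"
      by (rule detach[OF D_contrapos]) (use a N.prems dn[of "\<sim>a"] red in \<open>auto simp del: red.simps\<close>)
    moreover have "D Q (ctx n (subst ((!) [a, red a]) (\<sim>\<langle>1\<rangle> \<rightarrow> \<sim>\<langle>0\<rangle>)))"
      by (rule detach[OF D_contrapos]) (use a N.prems dn[of "\<sim>a"] red in \<open>auto simp del: red.simps\<close>)
    ultimately show ?thesis using red by (simp del: red.simps)
  qed
qed

text \<open>Detaching identity only instantiates identity, so removing a tag does not rename apart
  the variables it held together.\<close>

lemma D_ctx_elim: "D Q (ctx n F) \<Longrightarrow> dn_in Q F \<Longrightarrow> D Q F"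
proof (induction n)
  case (Suc n)
  then show ?case
    using D_detach_minor[of Q "\<lambda>_. \<langle>n\<rangle>" "\<langle>0\<rangle> \<rightarrow> \<langle>0\<rangle>" "ctx n F", OF _ D_id] by simp
qed simp

lemma D_if_red_instance:
  assumes "D Q C" "subst \<tau> C = red Q"
  shows "D Q Q"
proof -
  obtain n where "vars Q \<subseteq> {..<n}" using finite_vars finite_nat_set_iff_bounded by fastforce
  then have "D Q (ctx n (red Q \<rightarrow> Q))" using D_ctx_red dn_in_refl by blast
  then have "D Q (red Q \<rightarrow> Q)"
    by (rule D_ctx_elim) (simp add: dn_in_refl dn_in_if_free dn_free_red)
  \<comment> \<open>Unification specialises \<open>C\<close> to \<open>red Q\<close> and leaves the
    exact implication alone, so the conclusion is \<open>Q\<close> itself.\<close>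
  then show ?thesis
    using D_detach_minor[of Q \<tau> C Q] assms dn_in_refl by simp
qed

theorem theorem6:
  shows "admits_strong_dne {A1, A2, A3, A4}"
  unfolding admits_strong_dne_def
proof (intro allI impI, elim conjE)
  fix B Q assume "proves {A1, A2, A3, A4} B" "dn_star B Q"
  then have "red Q = red B" unfolding dn_star_def using red_dn_repl by blast
  moreover obtain C \<tau> where "D Q C" "subst \<tau> C = red (subst Var B)"
    using D_red_instance[OF proves_der] \<open>proves {A1, A2, A3, A4} B\<close> by blast
  ultimately have "D Q Q" using D_if_red_instance by simp
  from der_proof[OF this] show "\<exists>P. is_proof {A1, A2, A3, A4} P \<and> P \<noteq> [] \<and> last P = Q \<and>
      (\<forall>F\<in>deduced_steps {A1, A2, A3, A4} P. \<forall>t. \<sim>\<sim>t \<in> subforms F \<longrightarrow>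
        (\<exists>G\<in>subforms Q. variant (\<sim>\<sim>t) G))"
    unfolding dn_in_def .
qed

end
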